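(* Let $n\ge1$. The $W_t(j)$ coefficients for either of the two $\mathfrak{so}(2n)$ semispinorial quantum metrics (on $\mathcal{H}^{(n)}_+$ or $\mathcal{H}^{(n)}_-$) are given by $$W_t(j)=\frac1{2^{n-1}}\sum_{s=0}^{2t}(-1)^s\binom{2j}s\binom{2n-2j}{2t-s}$$ for integers $0\le t<n/2$ and $0\le j\le n/2$. If $n$ is even, then $$W_{n/2}(j)=\frac1{2^n}\sum_{s=0}^{n}(-1)^s\binom{2j}s\binom{2n-2j}{n-s}$$ for integers $0\le j\le n/2$.
   Context: Semispinorial quantum metrics: $\mathcal{H}^{(n)}=(\mathbb{C}^2)^{\otimes n}$ with computational basis $|x\rangle$, $x\in\{0,1\}^n$; $\mathcal{H}^{(n)}_+$ (resp. $\mathcal{H}^{(n)}_-$) is the span of the $|x\rangle$ with an even (resp. odd) number of ones, and $P_\pm$ is the orthogonal projection onto it. With Pauli matrices $\sigma_x,\sigma_y,\sigma_z$, put $U_k=\sigma_z^{\otimes k-1}\otimes\sigma_x\otimes I_2^{\otimes n-k}$ and $U_{n+k}=\sigma_z^{\otimes k-1}\otimes\sigma_y\otimes I_2^{\otimes n-k}$ for $1\le k\le n$. Let $\mathcal{E}=\operatorname{span}(\{P_\pm\}\cup\{P_\pm U_kU_lP_\pm:1\le k<l\le2n\})$, viewed as operators on $\mathcal{H}=\mathcal{H}^{(n)}_\pm$ (where $P_\pm$ is the identity); the $\mathfrak{so}(2n)$ semispinorial quantum metric on $\mathcal{H}^{(n)}_\pm$ is $\mathcal{E}_t=\mathbb{C}I_{\mathcal{H}}$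 for $0\le t<1$ and $\mathcal{E}_t=\mathcal{E}^{\lfloor t\rfloor}$ (span of products of $\lfloor t\rfloor$ elements) for $t\ge1$. The smallest $r$ with $\mathcal{E}_r=\mathcal{L}(\mathcal{H})$ is $r=\lfloor n/2\rfloor$. On $\mathcal{L}(\mathcal{H})$ use the Hilbert–Schmidt inner product $\operatorname{tr}(E^*F)$; put $\mathcal{V}_0=\mathbb{C}I_{\mathcal{H}}$ and $\mathcal{V}_t=\mathcal{E}_t\cap\mathcal{E}_{t-1}^\perp$ for $1\le t\le r$. $W_t(j)$ coefficients: for $\mathcal{B}_t$ any orthonormal basis of $\mathcal{V}_t$, let $\Phi_t(X)=\sum_{E\in\mathcal{B}_t}EXE^*$ and let $\Pi_t(X)=\sum_{E\in\mathcal{B}_t}\operatorname{tr}(E^*X)E$ (the orthogonal projection onto $\mathcal{V}_t$), as linear maps on the self-adjoint operators. The coefficients $W_t(j)\in\mathbb{R}$ are the unique numbers with $\Phi_t=\sum_{j=0}^{r}W_t(j)\Pi_j$ for $0\le t\le r$; equivalently $\Phi_t(X)=W_t(j)X$ for $X\in\mathcal{V}_j$ (such numbers exist for this metric). *)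

theory Defs
  imports "HOL-Analysis.Analysis"
begin

subsection \<open>Operators on a finite-dimensional Hilbert space as complex matrices\<close>

definition cscale :: "complex \<Rightarrow> complex^'m^'k \<Rightarrow> complex^'m^'k" where
  "cscale c A = map_matrix (\<lambda>z. c * z) A"

global_interpretation cmat: vector_space "cscale :: complex \<Rightarrow> complex^'m^'k \<Rightarrow> complex^'m^'k"
  by unfold_locales (simp_all add: cscale_def map_matrix_def vec_eq_iff algebra_simps)

definition adjoint_mat :: "complex^'m^'k \<Rightarrow> complex^'k^'m" where
  "adjoint_mat A = map_matrix cnj (transpose A)"

definition hs_inner :: "complex^'m^'m \<Rightarrow> complex^'m^'m \<Rightarrow> complex" where
  "hs_inner E F = trace (adjoint_mat E ** F)"

text \<open>
  If \<open>I\<close> is the orthogonal projection onto a subspace \<open>H\<close>, the operators on \<open>H\<close> are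
  identified with the matrices in the corner \<open>I L I\<close> of the full matrix algebra \<open>L\<close>. Products,
  adjoints and traces agree under this identification, and \<open>I\<close> is the identity operator of \<open>H\<close>.
\<close>

definition operators :: "complex^'m^'m \<Rightarrow> (complex^'m^'m) set" where
  "operators I = {X. I ** X ** I = X}"

definition selfadjoint_operators :: "complex^'m^'m \<Rightarrow> (complex^'m^'m) set" where
  "selfadjoint_operators I = {X \<in> operators I. adjoint_mat X = X}"

definition hs_complement :: "complex^'m^'m \<Rightarrow> (complex^'m^'m) set \<Rightarrow> (complex^'m^'m) set" where
  "hs_complement I S = {X \<in> operators I. \<forall>Y\<in>S. hs_inner Y X = 0}"

definition hs_orthonormal_basis :: "(complex^'m^'m) set \<Rightarrow> (complex^'m^'m) set \<Rightarrow> bool" where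
  "hs_orthonormal_basis B V \<longleftrightarrow>
     (\<forall>E\<in>B. \<forall>F\<in>B. hs_inner E F = (if E = F then 1 else 0)) \<and> cmat.span B = V"

definition operator_power :: "complex^'m^'m \<Rightarrow> (complex^'m^'m) set \<Rightarrow> nat \<Rightarrow> (complex^'m^'m) set" where
  "operator_power I S m = cmat.span {foldr (**) Fs I | Fs. set Fs \<subseteq> S \<and> length Fs = m}"


subsection \<open>The \<open>W\<close> coefficients of a filtration of operator spaces\<close>

text \<open>
  Below, \<open>E :: real \<Rightarrow> _ set\<close> is the quantum metric, on the Hilbert space whose identity operator
  is \<open>I\<close>.
\<close>

definition metric_radius :: "complex^'m^'m \<Rightarrow> (real \<Rightarrow> (complex^'m^'m) set) \<Rightarrow> nat" where
  "metric_radius I E = (LEAST r. E (real r) = operators I)"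

definition graded_part ::
    "complex^'m^'m \<Rightarrow> (real \<Rightarrow> (complex^'m^'m) set) \<Rightarrow> nat \<Rightarrow> (complex^'m^'m) set" where
  "graded_part I E t =
     (if t = 0 then cmat.span {I} else E (real t) \<inter> hs_complement I (E (real t - 1)))"

definition basis_twirl :: "(complex^'m^'m) set \<Rightarrow> complex^'m^'m \<Rightarrow> complex^'m^'m" where
  "basis_twirl B X = (\<Sum>E\<in>B. E ** X ** adjoint_mat E)"

definition basis_projection :: "(complex^'m^'m) set \<Rightarrow> complex^'m^'m \<Rightarrow> complex^'m^'m" where
  "basis_projection B X = (\<Sum>E\<in>B. cscale (hs_inner E X) E)"

definition is_W_coefficients ::
    "complex^'m^'m \<Rightarrow> (real \<Rightarrow> (complex^'m^'m) set) \<Rightarrow> nat \<Rightarrow> (nat \<Rightarrow> real) \<Rightarrow> bool" where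
  "is_W_coefficients I E t w \<longleftrightarrow>
     (\<forall>B. (\<forall>j\<le>metric_radius I E. hs_orthonormal_basis (B j) (graded_part I E j)) \<longrightarrow>
       (\<forall>X\<in>selfadjoint_operators I.
         basis_twirl (B t) X = (\<Sum>j\<le>metric_radius I E. w j *\<^sub>R basis_projection (B j) X)))"

text \<open>
  Extensionality makes the coefficient family \<open>w\<close>, which only matters on \<open>{0..r}\<close>, unique as a
  function; the definition is meaningful for \<open>t \<le> r\<close>, and its values for \<open>j \<le> r\<close>.
\<close>

definition W_coeff :: "complex^'m^'m \<Rightarrow> (real \<Rightarrow> (complex^'m^'m) set) \<Rightarrow> nat \<Rightarrow> nat \<Rightarrow> real" where
  "W_coeff I E t = (THE w. w \<in> extensional {..metric_radius I E} \<and> is_W_coefficients I E t w)"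


subsection \<open>Qubits\<close>

text \<open>
  The tensor factors are indexed by a finite linearly ordered type \<open>'n\<close> with \<open>CARD('n) = n\<close>, and a
  bit string of length \<open>n\<close> is a function \<open>x :: 'n \<Rightarrow> bool\<close>. Thus \<open>complex^('n \<Rightarrow> bool)\<close>
  is the \<open>n\<close>-fold tensor power of \<open>complex^bool\<close>, with computational basis
  \<open>axis x 1\<close>, and \<open>site\<close> is the order isomorphism from \<open>'n\<close> onto \<open>{1..n}\<close>.
\<close>

type_synonym 'n qubit_op = "complex^('n \<Rightarrow> bool)^('n \<Rightarrow> bool)"

definition site :: "'n::{finite,linorder} \<Rightarrow> nat" where
  "site i = card {..i}"

definition tensor_op :: "('n::finite \<Rightarrow> complex^bool^bool) \<Rightarrow> 'n qubit_op" where
  "tensor_op M = (\<chi> x y. \<Prod>i\<in>UNIV. M i $ x i $ y i)"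

text \<open>Row index first; \<open>False\<close> and \<open>True\<close> are the bits 0 and 1.\<close>

definition sigma_x :: "complex^bool^bool" where
  "sigma_x = (\<chi> a b. if a = b then 0 else 1)"

definition sigma_y :: "complex^bool^bool" where
  "sigma_y = (\<chi> a b. if a = b then 0 else if a then \<i> else - \<i>)"

definition sigma_z :: "complex^bool^bool" where
  "sigma_z = (\<chi> a b. if a \<noteq> b then 0 else if a then - 1 else 1)"

definition jordan_wigner :: "nat \<Rightarrow> complex^bool^bool \<Rightarrow> ('n::{finite,linorder}) qubit_op" where
  "jordan_wigner k S =
     tensor_op (\<lambda>i. if site i < k then sigma_z else if site i = k then S else mat 1)"

definition clifford_gen :: "nat \<Rightarrow> ('n::{finite,linorder}) qubit_op" where
  "clifford_gen k =
     (if k \<le> CARD('n) then jordan_wigner k sigma_x else jordan_wigner (k - CARD('n)) sigma_y)"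


subsection \<open>The semispinorial quantum metrics\<close>

datatype chirality = Plus | Minus

fun has_chirality :: "chirality \<Rightarrow> ('n::finite \<Rightarrow> bool) \<Rightarrow> bool" where
  "has_chirality Plus x \<longleftrightarrow> even (card {i. x i})"
| "has_chirality Minus x \<longleftrightarrow> odd (card {i. x i})"

definition semispin_space :: "chirality \<Rightarrow> (complex^('n::finite \<Rightarrow> bool)) set" where
  "semispin_space c = vec.span {axis x 1 | x. has_chirality c x}"

definition semispin_proj :: "chirality \<Rightarrow> ('n::finite) qubit_op" where
  "semispin_proj c = (\<chi> x y. if x = y \<and> has_chirality c x then 1 else 0)"

text \<open>
  \<open>semispin_proj c\<close> is the orthogonal projection onto \<open>semispin_space c\<close>.
\<close>

lemma semispin_proj_selfadjoint:
  "adjoint_mat (semispin_proj c) = (semispin_proj c :: ('n::finite) qubit_op)"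
  by (auto simp: semispin_proj_def adjoint_mat_def map_matrix_def transpose_def vec_eq_iff)

lemma semispin_proj_apply:
  "(semispin_proj c *v v) $ x = (if has_chirality c x then v $ x else 0)"
proof -
  have "(semispin_proj c *v v) $ x =
      (\<Sum>y\<in>UNIV. if y = x then (if has_chirality c x then v $ x else 0) else 0)"
    unfolding semispin_proj_def matrix_vector_mult_def vec_lambda_beta
    by (intro sum.cong) auto
  then show ?thesis by simp
qed

lemma semispin_proj_idem:
  "semispin_proj c ** semispin_proj c = (semispin_proj c :: ('n::finite) qubit_op)"
  by (auto simp: matrix_eq vec_eq_iff semispin_proj_apply simp flip: matrix_vector_mul_assoc)

lemma range_semispin_proj: "range ((*v) (semispin_proj c)) = semispin_space c"
proof
  show "range ((*v) (semispin_proj c)) \<subseteq> semispin_space c"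
  proof clarify
    fix v
    have "semispin_proj c *v v = (\<Sum>x\<in>{x. has_chirality c x}. v $ x *s axis x 1)"
      by (auto simp: vec_eq_iff semispin_proj_apply axis_def if_distrib cong: if_cong)
    also have "\<dots> \<in> semispin_space c"
      unfolding semispin_space_def
      by (intro vec.span_sum vec.span_scale vec.span_base) auto
    finally show "semispin_proj c *v v \<in> semispin_space c" .
  qed
next
  have "v = semispin_proj c *v v" if "v \<in> semispin_space c" for v
    using that unfolding semispin_space_def
  proof (induction rule: vec.span_induct_alt)
    case base
    show ?case by simp
  next
    case (step k b v)
    then have "semispin_proj c *v b = b"
      by (auto simp: vec_eq_iff semispin_proj_apply axis_def)
    then show ?case
      by (metis step.IH matrix_vector_right_distrib vector_scalar_commute)
  qed
  then show "semispin_space c \<subseteq> range ((*v) (semispin_proj c))" by blast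
qed

definition semispin_generators :: "chirality \<Rightarrow> ('n::{finite,linorder}) qubit_op set" where
  "semispin_generators c = cmat.span
     ({semispin_proj c} \<union>
      {semispin_proj c ** clifford_gen k ** clifford_gen l ** semispin_proj c | k l.
         1 \<le> k \<and> k < l \<and> l \<le> 2 * CARD('n)})"

definition semispin_metric :: "chirality \<Rightarrow> real \<Rightarrow> ('n::{finite,linorder}) qubit_op set" where
  "semispin_metric c t =
     (if t < 1 then cmat.span {semispin_proj c}
      else operator_power (semispin_proj c) (semispin_generators c) (nat \<lfloor>t\<rfloor>))"

end

theory Submission
  imports Defs
begin

text \<open>
  The monomials \<open>U\<^sub>S\<close> for \<open>S \<subseteq> {1..2n}\<close> in the Clifford generators form an orthogonal basis of all
  operators, and multiply by symmetric difference of index sets up to sign. Restricted to a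
  semispinor space, the odd ones vanish and \<open>U\<^sub>S\<close> becomes proportional to the monomial of the
  complement of \<open>S\<close>, since the top monomial is proportional to the chirality operator; these are
  the only relations. Hence the graded part of degree \<open>t\<close> is spanned by the \<open>U\<^sub>S\<close> with
  \<open>card S = 2t\<close>, and these form a tight frame for it. The twirl can be computed with a tight frame
  in place of an orthonormal basis, and for \<open>card T = 2j\<close> conjugation by \<open>U\<^sub>S\<close> multiplies \<open>U\<^sub>T\<close> by
  \<open>(-1)\<close> to the power \<open>card (S \<inter> T)\<close>. Summing this sign over all \<open>S\<close> with \<open>card S = 2t\<close> gives the
  stated sum.
\<close>

subsection \<open>Matrix calculus\<close>

lemma cscale_nth [simp]: "cscale c A $ i $ j = c * A $ i $ j"
  by (simp add: cscale_def map_matrix_def)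

lemma adjoint_mat_nth [simp]: "adjoint_mat A $ i $ j = cnj (A $ j $ i)"
  by (simp add: adjoint_mat_def map_matrix_def transpose_def)

lemma matrix_mult_nth: "(A ** B) $ i $ j = (\<Sum>k\<in>UNIV. A $ i $ k * B $ k $ j)"
  by (simp add: matrix_matrix_mult_def)

lemma cscale_mult_left [simp]: "cscale c A ** B = cscale c (A ** B)"
  by (simp add: vec_eq_iff matrix_mult_nth sum_distrib_left mult.assoc)

lemma cscale_mult_right [simp]: "A ** cscale c B = cscale c (A ** B)"
  by (simp add: vec_eq_iff matrix_mult_nth sum_distrib_left mult.left_commute)

lemma matrix_add_rdistrib: "(A + B) ** C = A ** C + B ** C" for C :: "complex^'m^'k"
  by (simp add: vec_eq_iff matrix_mult_nth sum.distrib algebra_simps)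

lemma matrix_mult_minus_left [simp]: "(- A) ** B = - (A ** B)" for A :: "complex^'m^'k"
  by (simp add: vec_eq_iff matrix_mult_nth sum_negf)

lemma matrix_mult_minus_right [simp]: "A ** (- B) = - (A ** B)" for A :: "complex^'m^'k"
  by (simp add: vec_eq_iff matrix_mult_nth sum_negf)

lemma matrix_mult_sum_left: "(\<Sum>i\<in>I. f i) ** B = (\<Sum>i\<in>I. f i ** B)"
  for B :: "complex^'m^'m"
  by (induction I rule: infinite_finite_induct) (simp_all add: matrix_add_rdistrib)

lemma matrix_mult_sum_right: "A ** (\<Sum>i\<in>I. f i) = (\<Sum>i\<in>I. A ** f i)"
  for A :: "complex^'m^'m"
  by (induction I rule: infinite_finite_induct) (simp_all add: matrix_add_ldistrib)

lemma adjoint_mat_mult: "adjoint_mat (A ** B) = adjoint_mat B ** adjoint_mat A"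
  by (simp add: vec_eq_iff matrix_mult_nth mult.commute)

lemma adjoint_mat_cscale [simp]: "adjoint_mat (cscale c A) = cscale (cnj c) (adjoint_mat A)"
  by (simp add: vec_eq_iff)

lemma adjoint_mat_add [simp]: "adjoint_mat (A + B) = adjoint_mat A + adjoint_mat B"
  by (simp add: vec_eq_iff)

lemma adjoint_mat_zero [simp]: "adjoint_mat 0 = 0"
  by (simp add: vec_eq_iff)

lemma adjoint_mat_sum: "adjoint_mat (\<Sum>i\<in>I. f i) = (\<Sum>i\<in>I. adjoint_mat (f i))"
  by (induction I rule: infinite_finite_induct) simp_all

lemma adjoint_mat_one [simp]: "adjoint_mat (mat 1) = mat 1"
  by (auto simp: vec_eq_iff mat_def)

lemma trace_cscale [simp]: "trace (cscale c A) = c * trace A"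
  by (simp add: trace_def sum_distrib_left)

lemma trace_minus [simp]: "trace (- A) = - trace A" for A :: "complex^'m^'m"
  by (simp add: trace_def sum_negf)

lemma scaleR_eq_cscale: "r *\<^sub>R A = cscale (of_real r) A" for A :: "complex^'m^'k"
  by (simp add: vec_eq_iff scaleR_conv_of_real[where 'a=complex])

text \<open>By bilinearity, induction over the left span and then over the right one leaves only
  products of spanning elements.\<close>

lemma mult_span_span:
  fixes X :: "complex^'m^'m"
  assumes "X \<in> cmat.span S" "Y \<in> cmat.span T"
    and "\<And>A B. A \<in> S \<Longrightarrow> B \<in> T \<Longrightarrow> A ** B \<in> cmat.span R"
  shows "X ** Y \<in> cmat.span R"
  using assms(1)
proof (induction rule: cmat.span_induct_alt)
  case (step c A X)
  have "A ** Y \<in> cmat.span R" using assms(2)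
    by (induction rule: cmat.span_induct_alt)
      (auto simp: matrix_add_ldistrib intro!: cmat.span_add cmat.span_scale cmat.span_zero assms(3) step)
  then show ?case
    using step by (auto simp: matrix_add_rdistrib intro!: cmat.span_add cmat.span_scale)
qed (simp add: cmat.span_zero)


subsection \<open>The Hilbert--Schmidt inner product\<close>

lemma hs_inner_eq_sum: "hs_inner A B = (\<Sum>i\<in>UNIV. \<Sum>j\<in>UNIV. cnj (A $ j $ i) * B $ j $ i)"
  by (simp add: hs_inner_def trace_def matrix_mult_nth)

lemma hs_inner_commute: "hs_inner A B = cnj (hs_inner B A)"
  by (simp add: hs_inner_eq_sum mult.commute)

lemma hs_inner_add_right [simp]: "hs_inner A (B + C) = hs_inner A B + hs_inner A C"
  by (simp add: hs_inner_eq_sum algebra_simps sum.distrib)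

lemma hs_inner_diff_right [simp]: "hs_inner A (B - C) = hs_inner A B - hs_inner A C"
  by (simp add: hs_inner_eq_sum algebra_simps sum_subtractf)

lemma hs_inner_cscale_right [simp]: "hs_inner A (cscale c B) = c * hs_inner A B"
  by (simp add: hs_inner_eq_sum algebra_simps sum_distrib_left)

lemma hs_inner_cscale_left [simp]: "hs_inner (cscale c A) B = cnj c * hs_inner A B"
  by (simp add: hs_inner_eq_sum algebra_simps sum_distrib_left)

lemma hs_inner_zero_right [simp]: "hs_inner A 0 = 0"
  by (simp add: hs_inner_eq_sum)

lemma hs_inner_sum_right: "hs_inner A (\<Sum>i\<in>I. f i) = (\<Sum>i\<in>I. hs_inner A (f i))"
  by (induction I rule: infinite_finite_induct) simp_all

lemma hs_inner_eq_0_commute: "hs_inner A B = 0 \<longleftrightarrow> hs_inner B A = 0"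
  by (metis hs_inner_commute complex_cnj_zero)

lemma hs_inner_self: "hs_inner A A = of_real (\<Sum>i\<in>UNIV. \<Sum>j\<in>UNIV. (norm (A $ j $ i))\<^sup>2)"
  unfolding hs_inner_eq_sum of_real_sum
  by (intro sum.cong refl) (metis complex_norm_square mult.commute of_real_power)

lemma hs_inner_self_eq_0_iff [simp]: "hs_inner A A = 0 \<longleftrightarrow> A = 0"
  by (auto simp: hs_inner_self sum_nonneg_eq_0_iff sum_nonneg vec_eq_iff simp del: of_real_sum)

lemma hs_inner_span_right:
  assumes "X \<in> cmat.span S" "\<And>B. B \<in> S \<Longrightarrow> hs_inner A B = 0"
  shows "hs_inner A X = 0"
  using assms(1) by (induction rule: cmat.span_induct_alt) (simp_all add: assms(2))

lemma hs_inner_span_span: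
  assumes "X \<in> cmat.span S" "Y \<in> cmat.span T"
    and "\<And>A B. A \<in> S \<Longrightarrow> B \<in> T \<Longrightarrow> hs_inner A B = 0"
  shows "hs_inner X Y = 0"
  by (metis assms hs_inner_eq_0_commute hs_inner_span_right)

lemma orthogonal_imp_independent:
  assumes "\<And>A. A \<in> S \<Longrightarrow> A \<noteq> 0"
    and "\<And>A B. A \<in> S \<Longrightarrow> B \<in> S \<Longrightarrow> A \<noteq> B \<Longrightarrow> hs_inner A B = 0"
  shows "cmat.independent S"
  unfolding cmat.dependent_def
proof clarify
  fix A assume "A \<in> S" "A \<in> cmat.span (S - {A})"
  then have "hs_inner A A = 0"
    by (intro hs_inner_span_right[of A "S - {A}"]) (auto simp: assms(2))
  with assms(1) \<open>A \<in> S\<close> show False by simp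
qed

section \<open>The dimension of the space of operators\<close>

definition matrix_unit :: "'m \<times> 'm \<Rightarrow> complex^'m^'m" where
  "matrix_unit p = (\<chi> i j. if (i, j) = p then 1 else 0)"

lemma span_matrix_units: "cmat.span (range matrix_unit) = UNIV"
proof -
  have "X \<in> cmat.span (range matrix_unit)" for X :: "complex^'m^'m"
  proof -
    have "(\<Sum>p\<in>UNIV. X $ fst p $ snd p * matrix_unit p $ i $ j)
        = (\<Sum>p\<in>UNIV. if p = (i, j) then X $ i $ j else 0)" for i j
      by (rule sum.cong) (auto simp: matrix_unit_def)
    then have "(\<Sum>p\<in>UNIV. cscale (X $ fst p $ snd p) (matrix_unit p)) = X"
      by (simp add: vec_eq_iff)
    moreover have "(\<Sum>p\<in>UNIV. cscale (X $ fst p $ snd p) (matrix_unit p)) \<in> cmat.span (range matrix_unit)"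
      by (intro cmat.span_sum cmat.span_scale cmat.span_base) simp
    ultimately show ?thesis by simp
  qed
  then show ?thesis by blast
qed

lemma card_matrix_units_le: "card (range matrix_unit :: (complex^'m^'m) set) \<le> CARD('m) * CARD('m)"
  using card_image_le[of UNIV "matrix_unit :: 'm \<times> 'm \<Rightarrow> complex^'m^'m"] by simp

text \<open>Dimension count: a maximal independent \<open>T\<close> containing \<open>S\<close> has
  at most as many elements as there are matrix units, hence no more than \<open>S\<close>, so
  \<open>T = S\<close>.\<close>

lemma span_eq_UNIV_if_independent:
  fixes S :: "(complex^'m^'m) set"
  assumes "cmat.independent S" "card S = CARD('m) * CARD('m)"
  shows "cmat.span S = UNIV"
proof -
  let ?U = "range matrix_unit :: (complex^'m^'m) set"
  obtain T where T: "S \<subseteq> T" "cmat.independent T" "UNIV \<subseteq> cmat.span T"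
    by (rule cmat.maximal_independent_subset_extend[OF subset_UNIV assms(1)])
  have fin: "finite T \<and> card T \<le> card ?U"
    by (rule cmat.independent_span_bound[OF _ T(2)]) (simp_all add: span_matrix_units)
  have "card T \<le> card S"
    using order_trans[OF conjunct2[OF fin] card_matrix_units_le] assms(2) by simp
  then have "S = T"
    by (rule card_seteq[OF conjunct1[OF fin] T(1)])
  then show ?thesis using T(3) by blast
qed


subsection \<open>Orthonormal bases\<close>

lemma hs_orthonormal_basis_finite:
  fixes B :: "(complex^'m^'m) set"
  assumes "hs_orthonormal_basis B V"
  shows "finite B"
proof -
  have "hs_inner E F = (if E = F then 1 else 0)" if "E \<in> B" "F \<in> B" for E F
    using assms that by (auto simp: hs_orthonormal_basis_def)
  then have "cmat.independent B"
    by (intro orthogonal_imp_independent) force+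
  then show ?thesis
    using cmat.independent_span_bound[of "range matrix_unit" B] by (auto simp: span_matrix_units)
qed

lemma basis_projection_on_span:
  assumes B: "hs_orthonormal_basis B V" and X: "X \<in> V"
  shows "basis_projection B X = X"
proof -
  have "X \<in> cmat.span B" using assms by (simp add: hs_orthonormal_basis_def)
  then show ?thesis
  proof (induction rule: cmat.span_induct_alt)
    case (step c A Y)
    have "basis_projection B (cscale c A + Y) =
        cscale c (\<Sum>E\<in>B. cscale (hs_inner E A) E) + basis_projection B Y"
      by (simp add: basis_projection_def cmat.scale_left_distrib sum.distrib cmat.scale_sum_right)
    also have "(\<Sum>E\<in>B. cscale (hs_inner E A) E) = (\<Sum>E\<in>B. if E = A then A else 0)"
      using B step(1) by (intro sum.cong) (auto simp: hs_orthonormal_basis_def)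
    also have "\<dots> = A"
      using hs_orthonormal_basis_finite[OF B] step(1) by simp
    finally show ?case using step by simp
  qed (simp add: basis_projection_def)
qed

lemma basis_projection_orthogonal:
  assumes "hs_orthonormal_basis B V" "\<And>Y. Y \<in> V \<Longrightarrow> hs_inner Y X = 0"
  shows "basis_projection B X = 0"
  using assms by (auto simp: basis_projection_def hs_orthonormal_basis_def cmat.span_base intro!: sum.neutral)

lemma basis_projection_residual:
  assumes "hs_orthonormal_basis B V" "E \<in> B"
  shows "hs_inner E (X - basis_projection B X) = 0"
proof -
  have "hs_inner E (basis_projection B X) = (\<Sum>F\<in>B. if F = E then hs_inner E X else 0)"
    unfolding basis_projection_def hs_inner_sum_right
    using assms by (intro sum.cong) (auto simp: hs_orthonormal_basis_def)
  also have "\<dots> = hs_inner E X"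
    using assms(2) hs_orthonormal_basis_finite[OF assms(1)] by simp
  finally show ?thesis by simp
qed

text \<open>Gram-Schmidt, one vector per induction step. The lemma supplies the bases over which
  \<open>is_W_coefficients\<close> quantifies.\<close>

lemma hs_orthonormal_basis_exists:
  assumes "finite S"
  shows "\<exists>B. hs_orthonormal_basis B (cmat.span S)"
  using assms
proof induction
  case empty
  have "hs_orthonormal_basis {} (cmat.span {})" by (simp add: hs_orthonormal_basis_def)
  then show ?case by blast
next
  case (insert A S)
  then obtain B where B: "hs_orthonormal_basis B (cmat.span S)" by blast
  \<comment> \<open>The component of \<open>A\<close> orthogonal to the basis \<open>B\<close> built
    so far; if it is zero then \<open>A\<close> adds nothing to the span, otherwise it is normalized
    to \<open>N\<close>.\<close>
  define D where "D = A - basis_projection B A"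
  have proj: "basis_projection B A \<in> cmat.span B"
    unfolding basis_projection_def by (rule cmat.span_sum, rule cmat.span_scale, erule cmat.span_base)
  have spB: "cmat.span B = cmat.span S" using B by (simp add: hs_orthonormal_basis_def)
  have span_eq: "cmat.span (insert D B) = cmat.span (insert A S)"
  proof -
    have "cmat.span (insert D B) = cmat.span (insert A B)"
      using cmat.eq_span_insert_eq[of A D B] proj by (simp add: D_def)
    also have "\<dots> = cmat.span (insert A S)"
      using spB by (simp add: cmat.span_insert)
    finally show ?thesis .
  qed
  show ?case
  proof (cases "D = 0")
    case True
    then have "cmat.span (insert A S) = cmat.span S"
      using span_eq spB by (simp add: cmat.span_insert_0)
    then show ?thesis using B by metis
  next
    case False
    obtain q where q: "hs_inner D D = of_real q" "q \<ge> 0"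
      by (rule that[OF hs_inner_self]) (simp add: sum_nonneg)
    with False have "q > 0" using hs_inner_self_eq_0_iff[of D] by (cases "q = 0") auto
    define N where "N = cscale (of_real (1 / sqrt q)) D"
    have "hs_inner N N = of_real (1 / sqrt q * (1 / sqrt q) * q)"
      by (simp add: N_def q flip: of_real_mult)
    also have "1 / sqrt q * (1 / sqrt q) * q = 1"
      using \<open>q > 0\<close> by (simp add: field_simps)
    finally have NN: "hs_inner N N = 1" by simp
    have EN: "hs_inner E N = 0 \<and> hs_inner N E = 0" if "E \<in> B" for E
    proof -
      have "hs_inner E D = 0" unfolding D_def by (rule basis_projection_residual[OF B that])
      then have "hs_inner E N = 0" by (simp add: N_def)
      then show ?thesis by (simp add: hs_inner_eq_0_commute)
    qed
    have "cmat.span (insert N B) = cmat.span (insert D B)"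
    proof (rule cmat.span_eq[THEN iffD2], intro conjI insert_subsetI)
      show "N \<in> cmat.span (insert D B)"
        unfolding N_def by (intro cmat.span_scale cmat.span_base) simp
      have "D = cscale (of_real (sqrt q)) N"
        using \<open>q > 0\<close> by (simp add: N_def flip: of_real_mult)
      then show "D \<in> cmat.span (insert N B)"
        by (metis cmat.span_scale cmat.span_base insertI1)
    qed (auto intro: cmat.span_base)
    with span_eq have "cmat.span (insert N B) = cmat.span (insert A S)" by simp
    then have "hs_orthonormal_basis (insert N B) (cmat.span (insert A S))"
      using B NN EN by (auto simp: hs_orthonormal_basis_def)
    then show ?thesis by blast
  qed
qed

section \<open>Linearity of twirl and projection, and the twirl from a tight frame\<close>

lemma basis_twirl_add: "basis_twirl B (X + Y) = basis_twirl B X + basis_twirl B Y"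
  by (simp add: basis_twirl_def matrix_add_ldistrib matrix_add_rdistrib sum.distrib)

lemma basis_twirl_cscale: "basis_twirl B (cscale c X) = cscale c (basis_twirl B X)"
  by (simp add: basis_twirl_def cmat.scale_sum_right)

lemma basis_projection_add:
  "basis_projection B (X + Y) = basis_projection B X + basis_projection B Y"
  by (simp add: basis_projection_def cmat.scale_left_distrib sum.distrib)

lemma basis_projection_cscale: "basis_projection B (cscale c X) = cscale c (basis_projection B X)"
  by (simp add: basis_projection_def cmat.scale_sum_right)

text \<open>Expand the left factor \<open>cscale K E\<close> in the frame and exchange the sums;
  what remains on the right is the expansion of \<open>F i\<close> in the basis \<open>B\<close>.
  This avoids choosing an orthonormal basis when the natural spanning family has linear
  relations.\<close>

lemma basis_twirl_tight_frame:
  fixes F :: "'i \<Rightarrow> complex^'m^'m"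
  assumes B: "hs_orthonormal_basis B V"
    and F: "\<And>i. i \<in> J \<Longrightarrow> F i \<in> V"
    and frame: "\<And>Y. Y \<in> V \<Longrightarrow> (\<Sum>i\<in>J. cscale (hs_inner (F i) Y) (F i)) = cscale K Y"
  shows "cscale K (basis_twirl B X) = (\<Sum>i\<in>J. F i ** X ** adjoint_mat (F i))"
proof -
  have EV: "E \<in> V" if "E \<in> B" for E
    using B that by (auto simp: hs_orthonormal_basis_def cmat.span_base)
  have "cscale K (basis_twirl B X) = (\<Sum>E\<in>B. cscale K E ** X ** adjoint_mat E)"
    by (simp add: basis_twirl_def cmat.scale_sum_right)
  also have "\<dots> = (\<Sum>E\<in>B. \<Sum>i\<in>J. cscale (hs_inner (F i) E) (F i ** X ** adjoint_mat E))"
    by (intro sum.cong refl) (simp add: matrix_mult_sum_left flip: frame[OF EV])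
  also have "\<dots> = (\<Sum>i\<in>J. \<Sum>E\<in>B. cscale (hs_inner (F i) E) (F i ** X ** adjoint_mat E))"
    by (rule sum.swap)
  \<comment> \<open>\<open>hs_inner (F i) E\<close> is the conjugate of the coefficient of
    \<open>E\<close> in \<open>F i\<close>, and taking adjoints restores exactly this
    conjugate.\<close>
  also have "\<dots> = (\<Sum>i\<in>J. F i ** X ** adjoint_mat (basis_projection B (F i)))"
    by (simp add: basis_projection_def adjoint_mat_sum matrix_mult_sum_right flip: hs_inner_commute)
  also have "\<dots> = (\<Sum>i\<in>J. F i ** X ** adjoint_mat (F i))"
    by (simp add: basis_projection_on_span[OF B F])
  finally show ?thesis .
qed


subsection \<open>Reading off the coefficients\<close>

text \<open>Existence follows by comparing two linear maps on the spanning spaces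
  \<open>V j\<close>; uniqueness follows by evaluating at a nonzero self-adjoint element of each
  \<open>V j\<close>.\<close>

lemma W_coeff_eqI:
  fixes I :: "complex^'m^'m" and E :: "real \<Rightarrow> (complex^'m^'m) set" and w :: "nat \<Rightarrow> real"
  defines "r \<equiv> metric_radius I E"
  defines "V \<equiv> graded_part I E"
  assumes fin: "\<And>j. j \<le> r \<Longrightarrow> \<exists>S. finite S \<and> V j = cmat.span S"
    and nontrivial: "\<And>j. j \<le> r \<Longrightarrow> \<exists>X \<in> V j \<inter> selfadjoint_operators I. X \<noteq> 0"
    and orth: "\<And>j k X Y. j \<le> r \<Longrightarrow> k \<le> r \<Longrightarrow> j \<noteq> k \<Longrightarrow> X \<in> V j \<Longrightarrow> Y \<in> V k \<Longrightarrow> hs_inner X Y = 0"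
    and total: "operators I \<subseteq> cmat.span (\<Union>j\<le>r. V j)"
    and eigen: "\<And>B j X. hs_orthonormal_basis B (V t) \<Longrightarrow> j \<le> r \<Longrightarrow> X \<in> V j \<Longrightarrow>
      basis_twirl B X = cscale (of_real (w j)) X"
    and "t \<le> r" "j \<le> r"
  shows "W_coeff I E t j = w j"
proof -
  have proj: "basis_projection (B k) X = (if k = i then X else 0)"
    if "hs_orthonormal_basis (B k) (V k)" "k \<le> r" "i \<le> r" "X \<in> V i" for B k i X
  proof (cases "k = i")
    case True
    with that show ?thesis using basis_projection_on_span by simp
  next
    case False
    then show ?thesis
      using basis_projection_orthogonal[OF that(1), of X] orth[OF that(2,3) False _ that(4)] by simp
  qed
  have sum_proj: "(\<Sum>k\<le>r. v k *\<^sub>R basis_projection (B k) X) = cscale (of_real (v i)) X"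
    if "\<forall>k\<le>r. hs_orthonormal_basis (B k) (V k)" "i \<le> r" "X \<in> V i" for B i X and v :: "nat \<Rightarrow> real"
  proof -
    have "(\<Sum>k\<le>r. v k *\<^sub>R basis_projection (B k) X) = (\<Sum>k\<le>r. if k = i then cscale (of_real (v i)) X else 0)"
      using that by (intro sum.cong) (auto simp: proj scaleR_eq_cscale)
    then show ?thesis using that by simp
  qed
  have coeff: "is_W_coefficients I E t w"
    unfolding is_W_coefficients_def r_def[symmetric] V_def[symmetric]
  proof (intro allI impI ballI)
    fix B X assume B: "\<forall>j\<le>r. hs_orthonormal_basis (B j) (V j)" and X: "X \<in> selfadjoint_operators I"
    have "X \<in> cmat.span (\<Union>j\<le>r. V j)" using X total by (auto simp: selfadjoint_operators_def)
    \<comment> \<open>Both sides are complex linear in \<open>X\<close>, so it suffices to compare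
      them on each \<open>V i\<close>, where only the \<open>i\<close>-th projection
      survives.\<close>
    then show "basis_twirl (B t) X = (\<Sum>j\<le>r. w j *\<^sub>R basis_projection (B j) X)"
    proof (induction rule: cmat.span_induct_alt)
      case base
      show ?case by (simp add: basis_twirl_def basis_projection_def)
    next
      case (step c A Y)
      then obtain i where i: "i \<le> r" "A \<in> V i" by auto
      have "basis_twirl (B t) A = (\<Sum>j\<le>r. w j *\<^sub>R basis_projection (B j) A)"
        using eigen[of "B t" i A] B i \<open>t \<le> r\<close> sum_proj[OF B i] by simp
      with step show ?case
        by (simp add: basis_twirl_add basis_twirl_cscale basis_projection_add basis_projection_cscale
            scaleR_eq_cscale cmat.scale_right_distrib sum.distrib cmat.scale_sum_right mult.commute)
    qed
  qed
  have unique: "v i = w i" if v: "is_W_coefficients I E t v" and i: "i \<le> r" for v i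
  proof -
    \<comment> \<open>\<open>is_W_coefficients\<close> speaks about all families of orthonormal
      bases, so it constrains \<open>v\<close> only once such a family is exhibited.\<close>
    have "\<forall>j. \<exists>B. j \<le> r \<longrightarrow> hs_orthonormal_basis B (V j)"
    proof
      fix j show "\<exists>B. j \<le> r \<longrightarrow> hs_orthonormal_basis B (V j)"
        using fin[of j] hs_orthonormal_basis_exists by (cases "j \<le> r") auto
    qed
    from choice[OF this] obtain B where B: "\<forall>j\<le>r. hs_orthonormal_basis (B j) (V j)" by blast
    obtain X where X: "X \<in> V i" "X \<in> selfadjoint_operators I" "X \<noteq> 0"
      using nontrivial[OF i] by blast
    have "basis_twirl (B t) X = cscale (of_real (v i)) X"
      using v X B sum_proj[OF B i X(1)] unfolding is_W_coefficients_def r_def V_def by simp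
    moreover have "basis_twirl (B t) X = cscale (of_real (w i)) X"
      using eigen B i X \<open>t \<le> r\<close> by simp
    ultimately show ?thesis using \<open>X \<noteq> 0\<close> by (simp add: cmat.scale_right_imp_eq)
  qed
  \<comment> \<open>The description operator ranges over extensional functions, so its value is
    \<open>w\<close> cut off to \<open>undefined\<close> above \<open>r\<close>.\<close>
  have "W_coeff I E t = restrict w {..r}"
    unfolding W_coeff_def r_def[symmetric]
  proof (rule the_equality)
    have "is_W_coefficients I E t (restrict w {..r})"
      using coeff unfolding is_W_coefficients_def r_def[symmetric] by simp
    then show "restrict w {..r} \<in> extensional {..r} \<and> is_W_coefficients I E t (restrict w {..r})"
      by simp
  next
    fix v assume "v \<in> extensional {..r} \<and> is_W_coefficients I E t v"
    then show "v = restrict w {..r}"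
      using unique by (auto intro!: extensionalityI[of v "{..r}"])
  qed
  then show ?thesis using \<open>j \<le> r\<close> by simp
qed


subsection \<open>Monomials in the generators of a Clifford system\<close>

locale clifford_system =
  fixes U :: "nat \<Rightarrow> complex^'m^'m" and n :: nat
  assumes card_dim: "CARD('m) = 2 ^ n"
    and n_pos: "n > 0"
    and U_square: "k \<in> {1..2*n} \<Longrightarrow> U k ** U k = mat 1"
    and U_anticommute:
      "k \<in> {1..2*n} \<Longrightarrow> l \<in> {1..2*n} \<Longrightarrow> k \<noteq> l \<Longrightarrow> U k ** U l = cscale (- 1) (U l ** U k)"
    and U_adjoint: "k \<in> {1..2*n} \<Longrightarrow> adjoint_mat (U k) = U k"
begin

text \<open>The factors appear in increasing order of index. The cutoff in the first argument allows
  induction with the index set fixed.\<close>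

primrec partial_monomial :: "nat \<Rightarrow> nat set \<Rightarrow> complex^'m^'m" where
  "partial_monomial 0 S = mat 1"
| "partial_monomial (Suc k) S = partial_monomial k S ** (if Suc k \<in> S then U (Suc k) else mat 1)"

definition monomial :: "nat set \<Rightarrow> complex^'m^'m" where
  "monomial S = partial_monomial (2*n) S"

text \<open>\<open>U k\<close> anticommutes with every factor except a possible copy of itself, so
  the sign counts the other factors.\<close>

lemma U_partial_monomial:
  assumes k: "k \<in> {1..2*n}" and "m \<le> 2*n"
  shows "U k ** partial_monomial m S =
    cscale ((- 1) ^ card (S \<inter> {1..m} - {k})) (partial_monomial m S ** U k)"
  using assms(2)
proof (induction m)
  case (Suc m)
  let ?e = "\<lambda>m. (- 1 :: complex) ^ card (S \<inter> {1..m} - {k})"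
  \<comment> \<open>The induction hypothesis with a trailing factor \<open>C\<close>, in the form in
    which it rewrites right-nested products.\<close>
  have *: "U k ** (partial_monomial m S ** C) = cscale (?e m) (partial_monomial m S ** (U k ** C))" for C
    using Suc by (simp add: matrix_mul_assoc)
  show ?case
  proof (cases "Suc m \<in> S \<and> Suc m \<noteq> k")
    case True
    then have "S \<inter> {1..Suc m} - {k} = insert (Suc m) (S \<inter> {1..m} - {k})" by auto
    then have "?e (Suc m) = - ?e m" by simp
    moreover have "U k ** U (Suc m) = cscale (- 1) (U (Suc m) ** U k)"
      using U_anticommute[of k "Suc m"] k True Suc.prems by simp
    ultimately show ?thesis using True by (simp add: * flip: matrix_mul_assoc)
  next
    case False
    then have "S \<inter> {1..Suc m} - {k} = S \<inter> {1..m} - {k}" by (auto simp: le_Suc_eq)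
    moreover have "k = Suc m" if "Suc m \<in> S" using False that by simp
    ultimately show ?thesis
      using Suc *[of "U k"] by (cases "Suc m \<in> S") (simp_all flip: matrix_mul_assoc)
  qed
qed simp

text \<open>Reordering the factors costs only signs, and a generator common to both products squares
  to the identity. The sign is left unspecified because the later traces and frames are insensitive
  to it.\<close>

lemma partial_monomial_mult:
  assumes "m \<le> 2*n"
  shows "\<exists>s\<in>{1, - 1}. partial_monomial m S ** partial_monomial m T =
    cscale s (partial_monomial m ((S - T) \<union> (T - S)))"
  using assms
proof (induction m)
  case (Suc m)
  define a where "a = (\<lambda>S. if Suc m \<in> S then U (Suc m) else mat 1)"
  let ?p = "partial_monomial m"
  have "m \<le> 2*n" using Suc.prems by simp
  from Suc.IH[OF this]
  obtain s where s: "s \<in> {1, - 1}" "?p S ** ?p T = cscale s (?p ((S - T) \<union> (T - S)))" by blast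
  obtain s' where s': "s' \<in> {1, - 1}" "a S ** ?p T = cscale s' (?p T ** a S)"
  proof (cases "Suc m \<in> S")
    case True
    with U_partial_monomial[of "Suc m" m T] Suc.prems show ?thesis
      by (intro that[of "(- 1) ^ card (T \<inter> {1..m} - {Suc m})"]) (auto simp: a_def minus_one_power_iff)
  qed (auto intro: that[of 1] simp: a_def)
  have a: "a S ** a T = a ((S - T) \<union> (T - S))"
    using U_square[of "Suc m"] Suc.prems by (auto simp: a_def)
  have "?p S ** a S ** (?p T ** a T) = ?p S ** (a S ** ?p T) ** a T"
    by (simp add: matrix_mul_assoc)
  also have "\<dots> = cscale s' ((?p S ** ?p T) ** (a S ** a T))"
    by (simp add: s' matrix_mul_assoc)
  also have "\<dots> = cscale (s' * s) (?p ((S - T) \<union> (T - S)) ** a ((S - T) \<union> (T - S)))"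
    by (simp add: s a)
  finally have "partial_monomial (Suc m) S ** partial_monomial (Suc m) T =
      cscale (s' * s) (partial_monomial (Suc m) ((S - T) \<union> (T - S)))"
    by (simp add: a_def)
  moreover have "s' * s \<in> {1, - 1}" using s s' by auto
  ultimately show ?case by blast
qed simp

lemma partial_monomial_unitary:
  assumes "m \<le> 2*n"
  shows "adjoint_mat (partial_monomial m S) ** partial_monomial m S = mat 1"
  using assms
proof (induction m)
  case (Suc m)
  define a where "a = (if Suc m \<in> S then U (Suc m) else mat 1)"
  have a: "adjoint_mat a ** a = mat 1"
    using Suc.prems U_square[of "Suc m"] U_adjoint[of "Suc m"] by (auto simp: a_def)
  have "adjoint_mat (partial_monomial m S ** a) ** (partial_monomial m S ** a) =
      adjoint_mat a ** (adjoint_mat (partial_monomial m S) ** partial_monomial m S) ** a"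
    by (simp add: adjoint_mat_mult matrix_mul_assoc)
  then show ?case using Suc a by (simp flip: a_def)
qed simp

lemma partial_monomial_singleton:
  "k \<ge> 1 \<Longrightarrow> partial_monomial m {k} = (if k \<le> m then U k else mat 1)"
  by (induction m) auto

lemma monomial_empty [simp]: "monomial {} = mat 1"
proof -
  have "partial_monomial m {} = mat 1" for m by (induction m) auto
  then show ?thesis by (simp add: monomial_def)
qed

lemma monomial_singleton: "k \<in> {1..2*n} \<Longrightarrow> monomial {k} = U k"
  by (simp add: monomial_def partial_monomial_singleton)

lemma U_monomial:
  assumes "k \<in> {1..2*n}" "S \<subseteq> {1..2*n}"
  shows "U k ** monomial S = cscale ((- 1) ^ card (S - {k})) (monomial S ** U k)"
proof -
  have "S \<inter> {1..2*n} = S" using assms by blast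
  then show ?thesis using U_partial_monomial[OF assms(1) order_refl, of S] by (simp add: monomial_def)
qed

lemma monomial_mult:
  "\<exists>s\<in>{1, - 1}. monomial S ** monomial T = cscale s (monomial ((S - T) \<union> (T - S)))"
  using partial_monomial_mult by (simp add: monomial_def)

lemma monomial_unitary:
  "adjoint_mat (monomial S) ** monomial S = mat 1" "monomial S ** adjoint_mat (monomial S) = mat 1"
proof -
  show "adjoint_mat (monomial S) ** monomial S = mat 1"
    by (simp add: monomial_def partial_monomial_unitary)
  then show "monomial S ** adjoint_mat (monomial S) = mat 1"
    by (rule matrix_left_right_inverse[THEN iffD1])
qed

text \<open>The square of a monomial is a sign, since the symmetric difference of \<open>S\<close>
  with itself is empty; for a unitary this makes the adjoint a signed copy of it.\<close>

lemma monomial_adjoint: "\<exists>s\<in>{1, - 1}. adjoint_mat (monomial S) = cscale s (monomial S)"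
proof -
  from monomial_mult[of S S] obtain s where "s \<in> {1, - 1}"
    "monomial S ** monomial S = cscale s (monomial ((S - S) \<union> (S - S)))" by blast
  then have s: "s \<in> {1, - 1}" "monomial S ** monomial S = cscale s (mat 1)" by simp_all
  have "adjoint_mat (monomial S) ** (monomial S ** monomial S) = monomial S"
    by (simp add: matrix_mul_assoc monomial_unitary)
  then have "cscale s (adjoint_mat (monomial S)) = monomial S" using s by simp
  then have "cscale (s * s) (adjoint_mat (monomial S)) = cscale s (monomial S)"
    by (metis cmat.scale_scale)
  with s show ?thesis by auto
qed

text \<open>Moving one \<open>U k\<close> past \<open>monomial T\<close> gives the parity of
  \<open>card (T - {k})\<close>. As \<open>card T\<close> is even, this is odd exactly when
  \<open>k \<in> T\<close>, so the signs accumulate over \<open>S \<inter> T\<close>.\<close>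

lemma partial_monomial_commute:
  assumes "m \<le> 2*n" "T \<subseteq> {1..2*n}" "even (card T)"
  shows "partial_monomial m S ** monomial T =
    cscale ((- 1) ^ card (S \<inter> T \<inter> {1..m})) (monomial T ** partial_monomial m S)"
  using assms(1)
proof (induction m)
  case (Suc m)
  let ?e = "\<lambda>m. (- 1 :: complex) ^ card (S \<inter> T \<inter> {1..m})"
  have fin: "finite T" using assms finite_subset by blast
  show ?case
  proof (cases "Suc m \<in> S")
    case True
    have sign: "(- 1) ^ card (T - {Suc m}) * ?e m = ?e (Suc m)"
    proof (cases "Suc m \<in> T")
      case True
      with \<open>Suc m \<in> S\<close> have "S \<inter> T \<inter> {1..Suc m} = insert (Suc m) (S \<inter> T \<inter> {1..m})" by auto
      moreover have "odd (card (T - {Suc m}))"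
        using True assms(3) fin by (metis card.remove even_Suc)
      ultimately show ?thesis by simp
    next
      case False
      then have "S \<inter> T \<inter> {1..Suc m} = S \<inter> T \<inter> {1..m}" by (auto simp: le_Suc_eq)
      then show ?thesis using False assms(3) by simp
    qed
    have "partial_monomial m S ** U (Suc m) ** monomial T =
        partial_monomial m S ** (U (Suc m) ** monomial T)"
      by (simp add: matrix_mul_assoc)
    also have "\<dots> = cscale ((- 1) ^ card (T - {Suc m})) (partial_monomial m S ** monomial T ** U (Suc m))"
      using U_monomial[of "Suc m" T] Suc.prems assms(2) by (simp add: matrix_mul_assoc)
    also have "\<dots> = cscale (?e (Suc m)) (monomial T ** partial_monomial m S ** U (Suc m))"
      using Suc sign by simp
    finally show ?thesis using True by (simp add: matrix_mul_assoc)
  next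
    case False
    then have "S \<inter> T \<inter> {1..Suc m} = S \<inter> T \<inter> {1..m}" by (auto simp: le_Suc_eq)
    then show ?thesis using False Suc by simp
  qed
qed simp

lemma monomial_commute:
  assumes "T \<subseteq> {1..2*n}" "even (card T)"
  shows "monomial S ** monomial T = cscale ((- 1) ^ card (S \<inter> T)) (monomial T ** monomial S)"
proof -
  have "S \<inter> T \<inter> {1..2*n} = S \<inter> T" using assms by blast
  then show ?thesis using partial_monomial_commute[OF order_refl assms, of S] by (simp add: monomial_def)
qed

section \<open>Traces and orthogonality of monomials\<close>

lemma trace_eq_0_if_anticommute:
  assumes k: "k \<in> {1..2*n}" and A: "U k ** A = cscale (- 1) (A ** U k)"
  shows "trace A = 0"
proof -
  have "trace A = trace (U k ** (U k ** A))" using k by (simp add: matrix_mul_assoc U_square)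
  \<comment> \<open>Anticommutation contributes the minus sign; cyclicity of the trace moves the
    first \<open>U k\<close> to the end.\<close>
  also have "\<dots> = - trace (A ** U k ** U k)"
    unfolding A by (simp add: trace_mul_sym[of "U k"])
  also have "\<dots> = - trace A" using k by (simp add: U_square flip: matrix_mul_assoc)
  finally show ?thesis by simp
qed

text \<open>Some generator anticommutes with the monomial: one inside \<open>S\<close> if
  \<open>card S\<close> is even, one outside if it is odd.\<close>

lemma trace_monomial:
  assumes "S \<subseteq> {1..2*n}" "S \<noteq> {}"
  shows "trace (monomial S) = 0"
proof -
  have fin: "finite S" using assms finite_subset by blast
  have "\<exists>k\<in>{1..2*n}. odd (card (S - {k}))"
  proof (cases "even (card S)")
    case True
    from assms obtain k where "k \<in> S" by blast
    with True fin have "odd (card (S - {k}))" by (metis card.remove even_Suc)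
    with \<open>k \<in> S\<close> assms show ?thesis by blast
  next
    case False
    \<comment> \<open>The full index set has even cardinality \<open>2 * n\<close>, so an odd
      \<open>S\<close> omits some index.\<close>
    then have "S \<noteq> {1..2*n}" by auto
    then obtain k where "k \<in> {1..2*n}" "k \<notin> S" using assms by blast
    with False show ?thesis by (intro bexI[of _ k]) simp_all
  qed
  then show ?thesis
    using trace_eq_0_if_anticommute U_monomial[OF _ assms(1)] by auto
qed

lemma trace_one: "trace (mat 1 :: complex^'m^'m) = 2 ^ n"
  by (simp add: trace_def mat_def card_dim)

text \<open>Up to sign, the inner product is the trace of the monomial of the symmetric difference,
  which vanishes unless that set is empty.\<close>

lemma hs_inner_monomial:
  assumes "S \<subseteq> {1..2*n}" "T \<subseteq> {1..2*n}"
  shows "hs_inner (monomial S) (monomial T) = (if S = T then 2 ^ n else 0)"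
proof (cases "S = T")
  case True
  then show ?thesis by (simp add: hs_inner_def monomial_unitary trace_one)
next
  case False
  then have "trace (monomial ((S - T) \<union> (T - S))) = 0"
    using assms by (intro trace_monomial) auto
  with False show ?thesis
    using monomial_adjoint[of S] monomial_mult[of S T] by (auto simp: hs_inner_def)
qed

text \<open>There are \<open>2 ^ (2 * n)\<close> orthogonal nonzero monomials, which is the
  dimension of the operators on a space of dimension \<open>2 ^ n\<close>.\<close>

lemma span_monomials: "cmat.span (monomial ` Pow {1..2*n}) = UNIV"
proof (rule span_eq_UNIV_if_independent)
  have ne: "monomial S \<noteq> 0" if "S \<subseteq> {1..2*n}" for S
    using hs_inner_monomial[OF that that] by auto
  then show "cmat.independent (monomial ` Pow {1..2*n})"
    by (intro orthogonal_imp_independent) (auto simp: hs_inner_monomial)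
  have "inj_on monomial (Pow {1..2*n})"
  proof (rule inj_onI)
    fix S T assume *: "S \<in> Pow {1..2*n}" "T \<in> Pow {1..2*n}" "monomial S = monomial T"
    then have "hs_inner (monomial S) (monomial T) = 2 ^ n" using hs_inner_monomial[of S S] by simp
    with * show "S = T" using hs_inner_monomial[of S T] by (auto split: if_splits)
  qed
  then show "card (monomial ` Pow {1..2*n}) = CARD('m) * CARD('m)"
    by (simp add: card_image card_Pow card_dim flip: power_add mult_2)
qed

lemma eq_0_if_orthogonal_monomials:
  assumes "\<And>S. S \<subseteq> {1..2*n} \<Longrightarrow> hs_inner (monomial S) X = 0"
  shows "X = 0"
proof -
  have "X \<in> cmat.span (monomial ` Pow {1..2*n})" unfolding span_monomials by (rule UNIV_I)
  then have "hs_inner X X = 0"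
    by (rule hs_inner_span_right) (use assms in \<open>auto simp: hs_inner_eq_0_commute[of X]\<close>)
  then show ?thesis by simp
qed

end


subsection \<open>The semispinor representation\<close>

text \<open>\<open>Z\<close> is the chirality operator and \<open>P\<close> projects onto its
  eigenspace for the eigenvalue 1. Since \<open>- Z\<close> satisfies the same axioms, both
  semispinor spaces are covered at once.\<close>

locale semispinor = clifford_system U n for U :: "nat \<Rightarrow> complex^'m^'m" and n +
  fixes Z P :: "complex^'m^'m"
  assumes Z_square: "Z ** Z = mat 1"
    and Z_adjoint: "adjoint_mat Z = Z"
    and Z_anticommute: "k \<in> {1..2*n} \<Longrightarrow> Z ** U k = cscale (- 1) (U k ** Z)"
    and P_eq: "P = cscale (1 / 2) (mat 1 + Z)"
begin

text \<open>\<open>Z\<close> anticommutes with all generators, so the product anticommutes with any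
  generator that commutes with \<open>monomial S\<close>. Such a generator lies outside
  \<open>S\<close> if \<open>card S\<close> is even and inside if it is odd.\<close>

lemma trace_monomial_Z:
  assumes "S \<subseteq> {1..2*n}" "S \<noteq> {1..2*n}"
  shows "trace (monomial S ** Z) = 0"
proof -
  have fin: "finite S" using assms finite_subset by blast
  have "\<exists>k\<in>{1..2*n}. even (card (S - {k}))"
  proof (cases "even (card S)")
    case True
    obtain k where "k \<in> {1..2*n}" "k \<notin> S" using assms by blast
    with True show ?thesis by (intro bexI[of _ k]) simp_all
  next
    case False
    then obtain k where "k \<in> S" by fastforce
    with False fin have "even (card (S - {k}))" by (metis card.remove even_Suc)
    with \<open>k \<in> S\<close> assms show ?thesis by blast
  qed
  then obtain k where k: "k \<in> {1..2*n}" "U k ** monomial S = monomial S ** U k"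
    using U_monomial[OF _ assms(1)] by auto
  have "cscale (- 1) (monomial S ** Z ** U k) = cscale (- 1) (monomial S ** (Z ** U k))"
    by (simp add: matrix_mul_assoc)
  also have "\<dots> = U k ** (monomial S ** Z)"
    using k by (simp add: Z_anticommute matrix_mul_assoc)
  finally show ?thesis
    by (intro trace_eq_0_if_anticommute[OF k(1)]) (rule sym)
qed

text \<open>All coefficients of \<open>Z\<close> in the orthogonal monomial basis vanish except the
  top one, and unitarity of \<open>Z\<close> makes this coefficient a phase.\<close>

lemma Z_eq_top_monomial: "\<exists>c. cnj c * c = 1 \<and> Z = cscale c (monomial {1..2*n})"
proof -
  let ?M = "monomial {1..2*n}"
  define c where "c = hs_inner ?M Z / 2 ^ n"
  have "Z - cscale c ?M = 0"
  proof (rule eq_0_if_orthogonal_monomials)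
    fix S assume S: "S \<subseteq> {1..2*n}"
    show "hs_inner (monomial S) (Z - cscale c ?M) = 0"
    proof (cases "S = {1..2*n}")
      case True
      then show ?thesis by (simp add: hs_inner_monomial c_def)
    next
      case False
      then have "hs_inner (monomial S) Z = 0"
        using trace_monomial_Z[OF S] monomial_adjoint[of S] by (auto simp: hs_inner_def)
      with False S show ?thesis by (simp add: hs_inner_monomial)
    qed
  qed
  then have Z: "Z = cscale c ?M" by simp
  have "mat 1 = adjoint_mat Z ** Z" by (simp add: Z_adjoint Z_square)
  also have "\<dots> = cscale (cnj c * c) (mat 1)"
    unfolding Z by (simp add: monomial_unitary mult.commute)
  finally have "trace (mat 1 :: complex^'m^'m) = cnj c * c * trace (mat 1 :: complex^'m^'m)"
    by (metis trace_cscale)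
  then have "cnj c * c = 1" by (simp add: trace_one)
  with Z show ?thesis by blast
qed

lemma P_idem: "P ** P = P"
proof -
  have "(mat 1 + Z) ** (mat 1 + Z) = cscale 2 (mat 1 + Z)"
    by (simp add: matrix_add_ldistrib matrix_add_rdistrib Z_square vec_eq_iff)
  then show ?thesis by (simp add: P_eq)
qed

lemma P_adjoint: "adjoint_mat P = P"
  by (simp add: P_eq Z_adjoint)

lemma Z_P: "Z ** P = P"
  by (simp add: P_eq matrix_add_ldistrib Z_square add.commute)

lemma Z_monomial:
  assumes "S \<subseteq> {1..2*n}"
  shows "Z ** monomial S = cscale ((- 1) ^ card S) (monomial S ** Z)"
proof -
  have "Z ** partial_monomial m S = cscale ((- 1) ^ card (S \<inter> {1..m})) (partial_monomial m S ** Z)"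
    if "m \<le> 2*n" for m
    using that
  proof (induction m)
    case (Suc m)
    have *: "Z ** (partial_monomial m S ** C) =
        cscale ((- 1) ^ card (S \<inter> {1..m})) (partial_monomial m S ** (Z ** C))" for C
      using Suc by (simp add: matrix_mul_assoc)
    show ?case
    proof (cases "Suc m \<in> S")
      case True
      then have "S \<inter> {1..Suc m} = insert (Suc m) (S \<inter> {1..m})" by auto
      with True show ?thesis
        using Z_anticommute[of "Suc m"] Suc.prems by (simp add: * flip: matrix_mul_assoc)
    next
      case False
      then have "S \<inter> {1..Suc m} = S \<inter> {1..m}" by (auto simp: le_Suc_eq)
      with False Suc show ?thesis by simp
    qed
  qed simp
  moreover have "S \<inter> {1..2*n} = S" using assms by blast
  ultimately show ?thesis using order_refl[of "2*n"] unfolding monomial_def by metis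
qed

lemma P_monomial_even:
  assumes "S \<subseteq> {1..2*n}" "even (card S)"
  shows "P ** monomial S = monomial S ** P"
  using Z_monomial[OF assms(1)] assms(2)
  by (simp add: P_eq matrix_add_ldistrib matrix_add_rdistrib)

text \<open>An odd monomial reverses chirality: it maps the range of \<open>P\<close> into the
  eigenspace of \<open>Z\<close> for the eigenvalue \<open>- 1\<close>, which \<open>P\<close>
  annihilates.\<close>

lemma P_monomial_odd:
  assumes "S \<subseteq> {1..2*n}" "odd (card S)"
  shows "P ** monomial S ** P = 0"
proof -
  have "Z ** monomial S ** P = cscale (- 1) (monomial S ** (Z ** P))"
    using Z_monomial[OF assms(1)] assms(2) by (simp add: matrix_mul_assoc)
  then have "(mat 1 + Z) ** monomial S ** P = 0"
    by (simp add: matrix_add_rdistrib Z_P)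
  then show ?thesis by (simp add: P_eq)
qed

section \<open>Monomials compressed to the semispinor space\<close>

definition semimonomial :: "nat set \<Rightarrow> complex^'m^'m" where
  "semimonomial S = monomial S ** P"

text \<open>Indexed by half the cardinality, so that up to \<open>n div 2\<close> the index agrees
  with the degree in the quantum metric.\<close>

definition level :: "nat \<Rightarrow> nat set set" where
  "level t = {S. S \<subseteq> {1..2*n} \<and> card S = 2 * t}"

lemma finite_level [simp]: "finite (level t)"
  by (rule finite_subset[of _ "Pow {1..2*n}"]) (auto simp: level_def)

lemma level_0: "level 0 = {{}}"
  by (auto simp: level_def finite_subset)

lemma level_nonempty:
  assumes "t \<le> n"
  shows "level t \<noteq> {}"
  using obtain_subset_with_card_n[of "2 * t" "{1..2*n}"] assms by (force simp: level_def)

text \<open>Counting removes the intersection twice from \<open>2 * i + 2 * j\<close>. The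
  subtraction is not truncated, since \<open>card (S \<inter> T)\<close> is at most both
  \<open>2 * i\<close> and \<open>2 * j\<close>.\<close>

lemma level_symdiff:
  assumes "S \<in> level i" "T \<in> level j"
  shows "(S - T) \<union> (T - S) \<in> level (i + j - card (S \<inter> T))"
proof -
  have fin: "finite S" "finite T"
    using assms by (auto simp: level_def intro: finite_subset)
  have "card ((S - T) \<union> (T - S)) = card (S - T) + card (T - S)"
    using fin by (intro card_Un_disjoint) auto
  moreover have "card S = card (S - T) + card (S \<inter> T)"
    using fin card_Diff_subset_Int[of S T] card_mono[of S "S \<inter> T"] by simp
  moreover have "card T = card (T - S) + card (S \<inter> T)"
    using fin card_Diff_subset_Int[of T S] card_mono[of T "S \<inter> T"] by (simp add: Int_commute)
  ultimately show ?thesis using assms by (auto simp: level_def)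
qed

lemma semimonomial_empty: "semimonomial {} = P"
  by (simp add: semimonomial_def)

text \<open>Even monomials commute with \<open>P\<close>, so the one-sided product in
  \<open>semimonomial\<close> is already the two-sided compression.\<close>

lemma P_semimonomial: "S \<in> level i \<Longrightarrow> P ** semimonomial S = semimonomial S"
  by (simp add: semimonomial_def level_def P_monomial_even matrix_mul_assoc)
    (simp add: P_idem flip: matrix_mul_assoc)

lemma semimonomial_P: "semimonomial S ** P = semimonomial S"
  by (simp add: semimonomial_def P_idem flip: matrix_mul_assoc)

lemma semimonomial_mult:
  assumes "T \<in> level j"
  shows "\<exists>s\<in>{1, - 1}. semimonomial S ** semimonomial T = cscale s (semimonomial ((S - T) \<union> (T - S)))"
proof -
  have "semimonomial S ** semimonomial T = monomial S ** (P ** semimonomial T)"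
    by (simp add: semimonomial_def matrix_mul_assoc)
  also have "\<dots> = monomial S ** monomial T ** P"
    unfolding P_semimonomial[OF assms] by (simp add: semimonomial_def matrix_mul_assoc)
  finally show ?thesis using monomial_mult[of S T] by (auto simp: semimonomial_def)
qed

lemma semimonomial_adjoint:
  assumes "S \<in> level i"
  shows "\<exists>s\<in>{1, - 1}. adjoint_mat (semimonomial S) = cscale s (semimonomial S)"
  using monomial_adjoint[of S] assms
  by (auto simp: semimonomial_def adjoint_mat_mult P_adjoint P_monomial_even level_def)

text \<open>On the semispinor space, the Hodge dual of a monomial is proportional to it, because the
  top monomial acts there as a scalar.\<close>

lemma semimonomial_complement:
  assumes "S \<subseteq> {1..2*n}"
  shows "\<exists>u. cnj u * u = 1 \<and> semimonomial ({1..2*n} - S) = cscale u (semimonomial S)"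
proof -
  let ?F = "{1..2*n}" and ?S' = "{1..2*n} - S"
  obtain c where c: "cnj c * c = 1" "Z = cscale c (monomial ?F)"
    using Z_eq_top_monomial by blast
  have diff: "(?S' - ?F) \<union> (?F - ?S') = S" using assms by auto
  from monomial_mult[of ?S' ?F]
  obtain s where s: "s \<in> {1, - 1}" "monomial ?S' ** monomial ?F = cscale s (monomial S)"
    unfolding diff by blast
  \<comment> \<open>\<open>Z\<close> acts as the identity on the range of \<open>P\<close>, so it
    can be inserted and then replaced by the top monomial.\<close>
  have "semimonomial ?S' = monomial ?S' ** (Z ** P)" by (simp add: semimonomial_def Z_P)
  also have "\<dots> = cscale c (monomial ?S' ** monomial ?F ** P)"
    by (simp add: c(2) matrix_mul_assoc)
  also have "\<dots> = cscale (c * s) (semimonomial S)"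
    by (simp only: s(2) semimonomial_def cscale_mult_left cmat.scale_scale)
  finally show ?thesis using c s by (intro exI[of _ "c * s"]) auto
qed

text \<open>Cyclicity of the trace merges the two projections into one, and \<open>P\<close> is then
  split into its two summands.\<close>

lemma hs_inner_semimonomial:
  "hs_inner (semimonomial S) (semimonomial T) =
    (trace (adjoint_mat (monomial S) ** monomial T) + trace (adjoint_mat (monomial S) ** monomial T ** Z)) / 2"
proof -
  have "hs_inner (semimonomial S) (semimonomial T) =
      trace (P ** (adjoint_mat (monomial S) ** monomial T ** P))"
    by (simp add: hs_inner_def semimonomial_def adjoint_mat_mult P_adjoint matrix_mul_assoc)
  also have "\<dots> = trace (adjoint_mat (monomial S) ** monomial T ** (P ** P))"
    by (subst trace_mul_sym) (simp add: matrix_mul_assoc)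
  also have "\<dots> = trace (adjoint_mat (monomial S) ** monomial T ** P)"
    by (simp add: P_idem)
  finally show ?thesis
    by (simp add: P_eq matrix_add_ldistrib trace_add)
qed

lemma hs_norm_semimonomial: "hs_inner (semimonomial S) (semimonomial S) = 2 ^ (n - 1)"
proof -
  have "trace Z = 0" using trace_monomial_Z[of "{}"] n_pos by simp
  then show ?thesis using n_pos
    by (simp add: hs_inner_semimonomial monomial_unitary trace_one power_diff)
qed

lemma semimonomial_nonzero: "semimonomial S \<noteq> 0"
  using hs_norm_semimonomial[of S] by auto

text \<open>The symmetric difference is neither empty nor full, so both traces in the preceding
  formula vanish.\<close>

lemma semimonomial_orthogonal:
  assumes "S \<subseteq> {1..2*n}" "T \<subseteq> {1..2*n}" "T \<noteq> S" "T \<noteq> {1..2*n} - S"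
  shows "hs_inner (semimonomial S) (semimonomial T) = 0"
proof -
  let ?D = "(S - T) \<union> (T - S)"
  have "?D \<subseteq> {1..2*n}" "?D \<noteq> {}" "?D \<noteq> {1..2*n}" using assms by blast+
  then have "trace (monomial ?D) = 0" "trace (monomial ?D ** Z) = 0"
    using trace_monomial trace_monomial_Z by blast+
  then show ?thesis
    using monomial_adjoint[of S] monomial_mult[of S T] by (auto simp: hs_inner_semimonomial)
qed

lemma level_orthogonal:
  assumes "S \<in> level i" "T \<in> level j" "i \<noteq> j" "i \<le> n div 2" "j \<le> n div 2"
  shows "hs_inner (semimonomial S) (semimonomial T) = 0"
proof (rule semimonomial_orthogonal)
  have "card ({1..2*n} - S) = 2 * n - 2 * i"
    using assms(1) finite_subset[of S "{1..2*n}"] by (simp add: level_def card_Diff_subset)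
  \<comment> \<open>\<open>i + j = n\<close> with both at most \<open>n div 2\<close> would force
    \<open>i = j\<close>.\<close>
  moreover have "2 * n - 2 * i \<noteq> 2 * j" using assms(3-5) by linarith
  ultimately show "T \<noteq> {1..2*n} - S" using assms(2) by (auto simp: level_def)
  have "card S \<noteq> card T" using assms(1-3) by (simp add: level_def)
  then show "T \<noteq> S" by blast
qed (use assms(1,2) in \<open>simp_all add: level_def\<close>)


subsection \<open>The filtration and its graded parts\<close>

definition filtration :: "nat \<Rightarrow> (complex^'m^'m) set" where
  "filtration t = cmat.span (semimonomial ` (\<Union>i\<le>t. level i))"

text \<open>Together with \<open>metric\<close>, this restates the semispinor construction for an
  abstract Clifford system.\<close>

definition generators :: "(complex^'m^'m) set" where
  "generators = cmat.span ({P} \<union> {P ** U k ** U l ** P | k l. 1 \<le> k \<and> k < l \<and> l \<le> 2 * n})"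

definition metric :: "real \<Rightarrow> (complex^'m^'m) set" where
  "metric t = (if t < 1 then cmat.span {P} else operator_power P generators (nat \<lfloor>t\<rfloor>))"

lemma filtration_base: "S \<in> level i \<Longrightarrow> i \<le> t \<Longrightarrow> semimonomial S \<in> filtration t"
  unfolding filtration_def by (intro cmat.span_base) auto

lemma generator_eq:
  assumes "1 \<le> k" "k < l" "l \<le> 2 * n"
  shows "\<exists>s\<in>{1, - 1}. P ** U k ** U l ** P = cscale s (semimonomial {k, l})"
proof -
  have diff: "({k} - {l}) \<union> ({l} - {k}) = {k, l}" using assms by auto
  have single: "monomial {k} = U k" "monomial {l} = U l"
    using assms by (simp_all add: monomial_singleton)
  from monomial_mult[of "{k}" "{l}"]
  obtain s where s: "s \<in> {1, - 1}" "U k ** U l = cscale s (monomial {k, l})"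
    unfolding diff single by blast
  have lev: "{k, l} \<in> level 1" using assms by (auto simp: level_def)
  have "P ** U k ** U l ** P = P ** (U k ** U l) ** P"
    by (simp only: matrix_mul_assoc)
  also have "\<dots> = cscale s (P ** semimonomial {k, l})"
    by (simp only: s(2) semimonomial_def cscale_mult_left cscale_mult_right matrix_mul_assoc)
  finally show ?thesis using s(1) unfolding P_semimonomial[OF lev] by blast
qed

lemma generators_eq: "generators = filtration 1"
proof
  have lev: "(\<Union>i\<le>1. level i) = insert {} (level 1)" by (auto simp: level_0 atMost_Suc)
  show "generators \<subseteq> filtration 1"
    unfolding generators_def
  proof (rule cmat.span_minimal)
    have "P \<in> filtration 1" using filtration_base[of "{}" 0] by (simp add: level_0 semimonomial_empty)
    moreover have "P ** U k ** U l ** P \<in> filtration 1" if "1 \<le> k" "k < l" "l \<le> 2 * n" for k l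
    proof -
      have "{k, l} \<in> level 1" using that by (auto simp: level_def)
      from filtration_base[OF this order_refl] generator_eq[OF that] show ?thesis
        unfolding filtration_def by (metis cmat.span_scale)
    qed
    ultimately show "{P} \<union> {P ** U k ** U l ** P | k l. 1 \<le> k \<and> k < l \<and> l \<le> 2 * n} \<subseteq> filtration 1"
      by auto
  qed (simp add: filtration_def)
  show "filtration 1 \<subseteq> generators"
    unfolding filtration_def lev
  proof (rule cmat.span_minimal)
    show "semimonomial ` insert {} (level 1) \<subseteq> generators"
    proof clarify
      fix S assume "S \<in> insert {} (level 1)"
      then consider "S = {}" | k l where "S = {k, l}" "1 \<le> k" "k < l" "l \<le> 2 * n"
      proof
        assume "S \<in> level 1"
        then obtain k l where "S = {k, l}" "k \<noteq> l" "{k, l} \<subseteq> {1..2*n}"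
          by (auto simp: level_def card_2_iff)
        then show thesis
          using that(2)[of k l] that(2)[of l k] by (cases "k < l") auto
      qed (rule that)
      then show "semimonomial S \<in> generators"
      proof cases
        case 1
        then show ?thesis by (simp add: semimonomial_empty generators_def cmat.span_base)
      next
        case 2
        then obtain s where s: "s \<in> {1, - 1}" "P ** U k ** U l ** P = cscale s (semimonomial S)"
          using generator_eq by metis
        then have "semimonomial S = cscale s (P ** U k ** U l ** P)" by auto
        also have "\<dots> \<in> generators"
          unfolding generators_def using 2 by (intro cmat.span_scale cmat.span_base) blast
        finally show ?thesis .
      qed
    qed
  qed (simp add: generators_def)
qed

text \<open>A symmetric difference has at most as many elements as the two sets together, so the
  levels add at most.\<close>

lemma filtration_mult:
  assumes "X \<in> filtration i" "Y \<in> filtration j"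
  shows "X ** Y \<in> filtration (i + j)"
  using assms unfolding filtration_def
proof (rule mult_span_span)
  fix A B assume "A \<in> semimonomial ` (\<Union>k\<le>i. level k)" "B \<in> semimonomial ` (\<Union>k\<le>j. level k)"
  then obtain k l S T where *: "k \<le> i" "l \<le> j" "S \<in> level k" "T \<in> level l"
      "A = semimonomial S" "B = semimonomial T" by auto
  obtain s where "A ** B = cscale s (semimonomial ((S - T) \<union> (T - S)))"
    using semimonomial_mult[OF *(4), of S] * by blast
  moreover have "semimonomial ((S - T) \<union> (T - S)) \<in> filtration (i + j)"
    using * by (intro filtration_base[OF level_symdiff[of S k T l]]) auto
  ultimately show "A ** B \<in> cmat.span (semimonomial ` (\<Union>k\<le>i + j. level k))"
    by (simp add: filtration_def cmat.span_scale)
qed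

text \<open>Indices are split off in pairs. Operator powers require exactly \<open>m\<close>
  factors, so shorter products are padded with \<open>P\<close>.\<close>

lemma semimonomial_factorization:
  assumes "S \<in> level i" "i \<le> m"
  shows "\<exists>Fs. set Fs \<subseteq> filtration 1 \<and> length Fs = m \<and>
    (\<exists>s\<in>{1, - 1}. semimonomial S = cscale s (foldr (**) Fs P))"
  using assms
proof (induction m arbitrary: S i)
  case 0
  then show ?case by (intro exI[of _ "[]"]) (simp add: level_0 semimonomial_empty)
next
  case (Suc m)
  obtain R T j k where RT: "R \<in> level j" "j \<le> 1" "T \<in> level k" "k \<le> m" "S = (R - T) \<union> (T - R)"
  proof (cases "i \<le> m")
    case True
    \<comment> \<open>Padding: the empty set contributes the factor \<open>P\<close>.\<close>
    with Suc show ?thesis by (intro that[of "{}" 0 S i]) (auto simp: level_0)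
  next
    case False
    with Suc have i: "i = Suc m" "card S = 2 * Suc m" "S \<subseteq> {1..2*n}" by (auto simp: level_def)
    then obtain R where R: "R \<subseteq> S" "card R = 2" "finite R"
      using obtain_subset_with_card_n[of 2 S] by auto
    with i have "card (S - R) = 2 * m" by (simp add: card_Diff_subset)
    with R i show ?thesis by (intro that[of R 1 "S - R" m]) (auto simp: level_def)
  qed
  obtain Fs s where Fs: "set Fs \<subseteq> filtration 1" "length Fs = m" "s \<in> {1, - 1}"
      "semimonomial T = cscale s (foldr (**) Fs P)"
    using Suc.IH[OF RT(3,4)] by blast
  obtain s' where s': "s' \<in> {1, - 1}" "semimonomial R ** semimonomial T = cscale s' (semimonomial S)"
    using semimonomial_mult[OF RT(3), of R] RT(5) by blast
  then have "semimonomial S = cscale s' (semimonomial R ** semimonomial T)" by auto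
  also have "\<dots> = cscale (s' * s) (foldr (**) (semimonomial R # Fs) P)"
    by (simp add: Fs(4))
  finally have "semimonomial S = cscale (s' * s) (foldr (**) (semimonomial R # Fs) P)" .
  moreover have "s' * s \<in> {1, - 1}" using Fs(3) s'(1) by auto
  moreover have "semimonomial R \<in> filtration 1" using RT filtration_base by blast
  ultimately show ?case
    using Fs by (intro exI[of _ "semimonomial R # Fs"]) auto
qed

lemma operator_power_generators: "operator_power P generators m = filtration m"
proof
  have P: "P \<in> filtration 0" using filtration_base[of "{}" 0] by (simp add: level_0 semimonomial_empty)
  have "foldr (**) Fs P \<in> filtration (length Fs)" if "set Fs \<subseteq> generators" for Fs
    using that
  proof (induction Fs)
    case (Cons F Fs)
    then show ?case using filtration_mult[of F 1 _ "length Fs"] by (simp add: generators_eq)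
  qed (simp add: P)
  then show "operator_power P generators m \<subseteq> filtration m"
    unfolding operator_power_def by (intro cmat.span_minimal) (auto simp: filtration_def)
  show "filtration m \<subseteq> operator_power P generators m"
    unfolding filtration_def
  proof (rule cmat.span_minimal)
    show "semimonomial ` (\<Union>i\<le>m. level i) \<subseteq> operator_power P generators m"
    proof clarify
      fix S i assume "S \<in> level i" "i \<le> m"
      from semimonomial_factorization[OF this, folded generators_eq] obtain Fs s where Fs: "set Fs \<subseteq> generators"
          "length Fs = m" "semimonomial S = cscale s (foldr (**) Fs P)"
        by blast
      show "semimonomial S \<in> operator_power P generators m"
        unfolding Fs(3) operator_power_def using Fs(1,2) by (intro cmat.span_scale cmat.span_base) blast
    qed
  qed (simp add: operator_power_def)
qed

section \<open>The ends of the filtration, the radius and the graded parts\<close>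

lemma filtration_0: "filtration 0 = cmat.span {P}"
  by (simp add: filtration_def level_0 semimonomial_empty)

lemma metric_of_nat: "metric (real m) = filtration m"
  by (cases m) (simp_all add: metric_def filtration_0 operator_power_generators nat_add_distrib)

text \<open>Every operator on the semispinor space is a combination of compressed monomials. The odd
  ones vanish, and the even ones of degree above \<open>n\<close> are replaced by their
  duals.\<close>

lemma filtration_top: "filtration (n div 2) = operators P"
proof
  show "filtration (n div 2) \<subseteq> operators P"
    unfolding filtration_def
  proof (rule cmat.span_minimal)
    show "cmat.subspace (operators P)"
      by (auto simp: cmat.subspace_def operators_def matrix_add_ldistrib matrix_add_rdistrib)
  qed (auto simp: operators_def P_semimonomial semimonomial_P)
  have mono: "P ** monomial S ** P \<in> filtration (n div 2)" if S: "S \<subseteq> {1..2*n}" for S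
  proof (cases "even (card S)")
    case False
    then show ?thesis using P_monomial_odd[OF S] by (simp add: filtration_def cmat.span_zero)
  next
    case True
    then obtain i where i: "card S = 2 * i" by blast
    have "P ** monomial S ** P = semimonomial S"
      using P_monomial_even[OF S True] semimonomial_P by (simp add: semimonomial_def)
    moreover have "semimonomial S \<in> filtration (n div 2)"
    proof (cases "i \<le> n div 2")
      case True
      then show ?thesis using S i filtration_base by (auto simp: level_def)
    next
      case False
      let ?S' = "{1..2*n} - S"
      have fin: "finite S" using S finite_subset by blast
      have "card ?S' = 2 * (n - i)" using S i fin by (simp add: card_Diff_subset)
      moreover have "n - i \<le> n div 2" using False by linarith
      ultimately have "semimonomial ?S' \<in> filtration (n div 2)"
        by (intro filtration_base) (auto simp: level_def)
      moreover obtain u where "semimonomial S = cscale u (semimonomial ?S')"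
        using semimonomial_complement[of ?S'] S by (auto simp: double_diff)
      ultimately show ?thesis by (simp add: filtration_def cmat.span_scale)
    qed
    ultimately show ?thesis by simp
  qed
  show "operators P \<subseteq> filtration (n div 2)"
  proof
    fix X assume "X \<in> operators P"
    \<comment> \<open>The compression is done one side at a time, expanding \<open>X\<close> in all
      monomials.\<close>
    have "P ** X \<in> cmat.span ((\<lambda>S. P ** monomial S) ` Pow {1..2*n})"
    proof (rule mult_span_span[of P "{P}" X "monomial ` Pow {1..2*n}"])
        show "X \<in> cmat.span (monomial ` Pow {1..2*n})" unfolding span_monomials by (rule UNIV_I)
    qed (auto intro!: cmat.span_base)
    then have "P ** X ** P \<in> filtration (n div 2)"
      unfolding filtration_def
    proof (rule mult_span_span[of _ _ P "{P}"])
      fix A B assume "A \<in> (\<lambda>S. P ** monomial S) ` Pow {1..2*n}" "B \<in> {P}"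
      then show "A ** B \<in> cmat.span (semimonomial ` (\<Union>i\<le>n div 2. level i))"
        using mono by (auto simp: filtration_def)
    qed (auto intro: cmat.span_base)
    then show "X \<in> filtration (n div 2)" using \<open>X \<in> operators P\<close> by (simp add: operators_def)
  qed
qed

text \<open>A semimonomial of level \<open>n div 2\<close> is orthogonal to all lower levels but not
  zero, so no smaller stage is everything.\<close>

lemma metric_radius_eq: "metric_radius P metric = n div 2"
  unfolding metric_radius_def
proof (rule Least_equality)
  show "metric (real (n div 2)) = operators P" by (simp only: metric_of_nat filtration_top)
  fix r assume r: "metric (real r) = operators P"
  show "n div 2 \<le> r"
  proof (rule ccontr)
    assume "\<not> n div 2 \<le> r"
    obtain S where S: "S \<in> level (n div 2)" using level_nonempty[of "n div 2"] by fastforce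
    then have "semimonomial S \<in> filtration r"
      using filtration_base[OF S order_refl] r by (simp only: metric_of_nat filtration_top)
    then have "hs_inner (semimonomial S) (semimonomial S) = 0"
      unfolding filtration_def
      by (rule hs_inner_span_right) (use S \<open>\<not> n div 2 \<le> r\<close> in \<open>auto intro!: level_orthogonal\<close>)
    then show False by (simp add: semimonomial_nonzero)
  qed
qed

text \<open>Each stage is the orthogonal sum of the previous stage and the new level.\<close>

lemma graded_part_eq:
  assumes "t \<le> n div 2"
  shows "graded_part P metric t = cmat.span (semimonomial ` level t)"
proof (cases t)
  case 0
  then show ?thesis by (simp add: graded_part_def level_0 semimonomial_empty)
next
  case (Suc m)
  have orth: "hs_inner X Y = 0" if "X \<in> filtration m" "Y \<in> cmat.span (semimonomial ` level t)" for X Y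
    using that unfolding filtration_def
    by (rule hs_inner_span_span) (use Suc assms in \<open>auto intro!: level_orthogonal\<close>)
  have split: "filtration t = {X + Y | X Y. X \<in> filtration m \<and> Y \<in> cmat.span (semimonomial ` level t)}"
  proof -
    have "(\<Union>i\<le>t. level i) = (\<Union>i\<le>m. level i) \<union> level t"
      using Suc by (auto simp: atMost_Suc)
    then show ?thesis unfolding filtration_def by (simp only: image_Un cmat.span_Un)
  qed
  have sub: "filtration t \<subseteq> operators P"
    unfolding filtration_top[symmetric] filtration_def using assms
    by (intro cmat.span_mono image_mono UN_mono) auto
  have "filtration t \<inter> hs_complement P (filtration m) = cmat.span (semimonomial ` level t)"
  proof (intro equalityI subsetI)
    fix W assume W: "W \<in> filtration t \<inter> hs_complement P (filtration m)"
    then obtain X Y where XY: "W = X + Y" "X \<in> filtration m" "Y \<in> cmat.span (semimonomial ` level t)"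
      unfolding split by blast
    \<comment> \<open>\<open>X\<close> is orthogonal to \<open>W\<close> and to \<open>Y\<close>,
      hence to itself.\<close>
    have "hs_inner X W = 0" using W XY by (simp add: hs_complement_def)
    then have "X = 0" using orth[OF XY(2,3)] XY(1) by simp
    with XY show "W \<in> cmat.span (semimonomial ` level t)" by simp
  next
    fix Y assume Y: "Y \<in> cmat.span (semimonomial ` level t)"
    have "Y \<in> filtration t"
      using Y cmat.span_mono[of "semimonomial ` level t" "semimonomial ` (\<Union>i\<le>t. level i)"]
      by (auto simp: filtration_def)
    with Y sub orth show "Y \<in> filtration t \<inter> hs_complement P (filtration m)"
      by (auto simp: hs_complement_def)
  qed
  moreover have "graded_part P metric t = metric (real t) \<inter> hs_complement P (metric (real m))"
    using Suc by (simp add: graded_part_def)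
  ultimately show ?thesis by (simp only: metric_of_nat)
qed

end


subsection \<open>The eigenvalues of the twirl\<close>

text \<open>Group the sets \<open>S\<close> by \<open>s = card (S \<inter> T)\<close>: such a set is
  a choice of \<open>s\<close> elements inside \<open>T\<close> and \<open>k - s\<close> elements
  outside.\<close>

lemma sum_sign_card_Int_subsets:
  assumes "finite A" "T \<subseteq> A"
  shows "(\<Sum>S | S \<subseteq> A \<and> card S = k. (- 1 :: 'a::comm_ring_1) ^ card (S \<inter> T)) =
    (\<Sum>s = 0..k. (- 1) ^ s * of_nat (card T choose s) * of_nat ((card A - card T) choose (k - s)))"
proof -
  let ?X = "{S. S \<subseteq> A \<and> card S = k}"
  have fin: "finite T" "finite (A - T)" "finite ?X"
    using assms finite_subset by auto
  have card: "card {S \<in> ?X. card (S \<inter> T) = s} =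
      (card T choose s) * ((card A - card T) choose (k - s))" if "s \<le> k" for s
  proof -
    let ?Y = "{B. B \<subseteq> T \<and> card B = s}" and ?Z = "{C. C \<subseteq> A - T \<and> card C = k - s}"
    have union: "B \<union> C \<in> {S \<in> ?X. card (S \<inter> T) = s}" if BC: "B \<in> ?Y" "C \<in> ?Z" for B C
    proof -
      have "(B \<union> C) \<inter> T = B" "B \<inter> C = {}" using BC by auto
      moreover have "finite B" "finite C"
        using BC finite_subset[OF _ fin(1), of B] finite_subset[OF _ fin(2), of C] by auto
      ultimately show ?thesis
        using BC assms(2) \<open>s \<le> k\<close> by (auto simp: card_Un_disjoint)
    qed
    have split: "S \<inter> T \<in> ?Y \<and> S - T \<in> ?Z" if S: "S \<in> {S \<in> ?X. card (S \<inter> T) = s}" for S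
    proof -
      have "finite S" using S finite_subset[OF _ assms(1), of S] by blast
      then have "card (S - T) = card S - card (S \<inter> T)" by (intro card_Diff_subset_Int) auto
      with S show ?thesis by auto
    qed
    have "bij_betw (\<lambda>(B, C). B \<union> C) (?Y \<times> ?Z) {S \<in> ?X. card (S \<inter> T) = s}"
      by (rule bij_betw_byWitness[where f' = "\<lambda>S. (S \<inter> T, S - T)"]) (use union split assms(2) in auto)
    then have "card {S \<in> ?X. card (S \<inter> T) = s} = card (?Y \<times> ?Z)"
      by (simp add: bij_betw_same_card)
    also have "\<dots> = (card T choose s) * (card (A - T) choose (k - s))"
      using fin by (simp add: card_cartesian_product n_subsets)
    also have "card (A - T) = card A - card T"
      using assms fin by (simp add: card_Diff_subset)
    finally show ?thesis .
  qed
  have le: "card (S \<inter> T) \<le> k" if "S \<in> ?X" for S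
    using that assms finite_subset by (auto intro!: card_mono)
  have "(\<Sum>S\<in>?X. (- 1 :: 'a) ^ card (S \<inter> T)) =
      (\<Sum>s = 0..k. \<Sum>S | S \<in> ?X \<and> card (S \<inter> T) = s. (- 1) ^ card (S \<inter> T))"
    using fin(3) le by (intro sum.group[symmetric]) auto
  also have "\<dots> = (\<Sum>s = 0..k. (- 1) ^ s * of_nat (card {S \<in> ?X. card (S \<inter> T) = s}))"
    by (intro sum.cong) (simp_all add: mult.commute)
  also have "\<dots> = (\<Sum>s = 0..k. (- 1) ^ s * of_nat (card T choose s) * of_nat ((card A - card T) choose (k - s)))"
    by (intro sum.cong refl) (simp only: card atLeastAtMost_iff of_nat_mult mult.assoc)
  finally show ?thesis by simp
qed

context semispinor
begin

text \<open>The binary Krawtchouk polynomial of length \<open>2 * n\<close> and degree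
  \<open>2 * t\<close>, evaluated at \<open>2 * j\<close>.\<close>

definition krawtchouk :: "nat \<Rightarrow> nat \<Rightarrow> real" where
  "krawtchouk t j = (\<Sum>s = 0..2 * t. (- 1) ^ s * real ((2 * j) choose s) * real ((2 * n - 2 * j) choose (2 * t - s)))"

text \<open>In the middle degree each one-dimensional space is spanned by both a monomial and its dual,
  so that the frame of all monomials covers it twice.\<close>

definition frame_const :: "nat \<Rightarrow> real" where
  "frame_const t = (if 2 * t = n then 2 ^ n else 2 ^ (n - 1))"

lemma frame_const_pos: "frame_const t > 0"
  by (simp add: frame_const_def)

text \<open>For a spanning element indexed by \<open>T\<close>, only the sets \<open>T\<close> and
  its complement contribute, and the complement has the right cardinality exactly when
  \<open>2 * t = n\<close>.\<close>

lemma semimonomial_frame: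
  assumes t: "2 * t \<le> n" and Y: "Y \<in> cmat.span (semimonomial ` level t)"
  shows "(\<Sum>S\<in>level t. cscale (hs_inner (semimonomial S) Y) (semimonomial S)) =
    cscale (of_real (frame_const t)) Y"
  using Y
proof (induction rule: cmat.span_induct_alt)
  case (step c A Y)
  let ?f = "\<lambda>A S. cscale (hs_inner (semimonomial S) A) (semimonomial S)"
  obtain T where T: "T \<in> level t" "A = semimonomial T" using step by blast
  then have T': "T \<subseteq> {1..2*n}" "card T = 2 * t" "finite T"
    by (auto simp: level_def intro: finite_subset)
  let ?T' = "{1..2*n} - T"
  have card_T': "card ?T' = 2 * n - 2 * t"
    using T' by (simp add: card_Diff_subset)
  have zero: "?f A S = 0" if "S \<in> level t" "S \<noteq> T" "S \<noteq> ?T'" for S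
  proof -
    have "T \<noteq> {1..2*n} - S"
      using that T' by (metis (no_types, lifting) double_diff level_def mem_Collect_eq order_refl)
    then have "hs_inner (semimonomial S) (semimonomial T) = 0"
      using that T' by (intro semimonomial_orthogonal) (auto simp: level_def)
    then show ?thesis by (simp add: T)
  qed
  have self_norm: "hs_inner A A = 2 ^ (n - 1)" by (simp add: T hs_norm_semimonomial)
  then have self: "?f A T = cscale (2 ^ (n - 1)) A" by (simp add: T)
  have "(\<Sum>S\<in>level t. ?f A S) = cscale (of_real (frame_const t)) A"
  proof (cases "2 * t = n")
    case False
    then have "card ?T' \<noteq> 2 * t" using card_T' t by linarith
    then have "(\<Sum>S\<in>level t. ?f A S) = (\<Sum>S\<in>{T}. ?f A S)"
      using T(1) zero by (intro sum.mono_neutral_right) (auto simp: level_def)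
    then show ?thesis using False self by (simp add: frame_const_def)
  next
    case True
    have "?T' \<in> level t" using True card_T' by (auto simp: level_def)
    moreover have "?T' \<noteq> T" using True n_pos T' by (metis Diff_disjoint Int_absorb card.empty not_gr0)
    moreover obtain u where u: "cnj u * u = 1" "semimonomial ?T' = cscale u A"
      using semimonomial_complement[OF T'(1)] T by blast
    moreover have "(\<Sum>S\<in>level t. ?f A S) = (\<Sum>S\<in>{T, ?T'}. ?f A S)"
      using T(1) \<open>?T' \<in> level t\<close> zero by (intro sum.mono_neutral_right) auto
    ultimately have "(\<Sum>S\<in>level t. ?f A S) = ?f A T + ?f A ?T'" by simp
    \<comment> \<open>The phase \<open>u\<close> enters once conjugated and once not, so it cancels
      and the dual contributes as much as \<open>T\<close> itself.\<close>
    also have "?f A ?T' = cscale (cnj u * u * 2 ^ (n - 1)) A"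
      by (simp only: u(2) hs_inner_cscale_left cmat.scale_scale self_norm) (simp only: mult_ac)
    also have "?f A T + cscale (cnj u * u * 2 ^ (n - 1)) A = cscale (2 ^ (n - 1) + 2 ^ (n - 1)) A"
      unfolding u(1) self cmat.scale_left_distrib by simp
    also have "(2 ^ (n - 1) + 2 ^ (n - 1) :: complex) = 2 ^ n"
      using n_pos by (cases n) simp_all
    finally show ?thesis using True by (simp add: frame_const_def)
  qed
  moreover have "(\<Sum>S\<in>level t. ?f (cscale c A + Y) S) =
      cscale c (\<Sum>S\<in>level t. ?f A S) + (\<Sum>S\<in>level t. ?f Y S)"
    by (simp add: cmat.scale_left_distrib sum.distrib cmat.scale_sum_right)
  ultimately show ?case
    using step by (simp add: cmat.scale_right_distrib mult.commute)
qed simp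

text \<open>The projections are absorbed because they commute with even monomials. Commuting
  \<open>monomial S\<close> past \<open>monomial T\<close> gives the sign, and unitarity removes
  \<open>monomial S\<close>.\<close>

lemma semimonomial_conjugation:
  assumes "S \<in> level i" "T \<in> level j"
  shows "semimonomial S ** semimonomial T ** adjoint_mat (semimonomial S) =
    cscale ((- 1) ^ card (S \<inter> T)) (semimonomial T)"
proof -
  have T: "T \<subseteq> {1..2*n}" "even (card T)" using assms by (auto simp: level_def)
  have S: "S \<subseteq> {1..2*n}" "even (card S)" using assms by (auto simp: level_def)
  have "adjoint_mat (semimonomial S) = P ** adjoint_mat (monomial S)"
    by (simp add: semimonomial_def adjoint_mat_mult P_adjoint)
  then have "semimonomial S ** semimonomial T ** adjoint_mat (semimonomial S) =
      monomial S ** (P ** semimonomial T ** P) ** adjoint_mat (monomial S)"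
    by (simp add: semimonomial_def matrix_mul_assoc)
  also have "\<dots> = monomial S ** (P ** monomial T) ** adjoint_mat (monomial S)"
    unfolding P_semimonomial[OF assms(2)] semimonomial_P P_monomial_even[OF T]
    by (simp add: semimonomial_def)
  also have "\<dots> = (monomial S ** P) ** monomial T ** adjoint_mat (monomial S)"
    by (simp add: matrix_mul_assoc)
  also have "\<dots> = P ** (monomial S ** monomial T) ** adjoint_mat (monomial S)"
    unfolding P_monomial_even[OF S, symmetric] by (simp add: matrix_mul_assoc)
  also have "\<dots> = cscale ((- 1) ^ card (S \<inter> T)) (P ** monomial T ** (monomial S ** adjoint_mat (monomial S)))"
    unfolding monomial_commute[OF T] by (simp add: matrix_mul_assoc)
  also have "\<dots> = cscale ((- 1) ^ card (S \<inter> T)) (semimonomial T)"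
    unfolding monomial_unitary P_monomial_even[OF T] by (simp add: semimonomial_def)
  finally show ?thesis .
qed

text \<open>The tight frame replaces the basis, each conjugation contributes a sign, and the total
  of the signs depends only on \<open>card T\<close>.\<close>

lemma basis_twirl_eigen:
  assumes t: "2 * t \<le> n" and B: "hs_orthonormal_basis B (cmat.span (semimonomial ` level t))"
    and X: "X \<in> cmat.span (semimonomial ` level j)"
  shows "basis_twirl B X = cscale (of_real (krawtchouk t j / frame_const t)) X"
  using X
proof (induction rule: cmat.span_induct_alt)
  case base
  show ?case by (simp add: basis_twirl_def)
next
  case (step c A Y)
  then obtain T where T: "T \<in> level j" "A = semimonomial T" by blast
  have T': "T \<subseteq> {1..2*n}" "card T = 2 * j" using T(1) by (auto simp: level_def)
  have lev: "level t = {S. S \<subseteq> {1..2*n} \<and> card S = 2 * t}" by (simp add: level_def)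
  have "cscale (of_real (frame_const t)) (basis_twirl B A) =
      (\<Sum>S\<in>level t. semimonomial S ** A ** adjoint_mat (semimonomial S))"
    by (rule basis_twirl_tight_frame[OF B _ semimonomial_frame[OF t]]) (auto intro: cmat.span_base)
  also have "\<dots> = (\<Sum>S\<in>level t. cscale ((- 1) ^ card (S \<inter> T)) A)"
    unfolding T(2) by (intro sum.cong refl semimonomial_conjugation[OF _ T(1)])
  also have "\<dots> = cscale (\<Sum>S\<in>level t. (- 1) ^ card (S \<inter> T)) A"
    by (simp only: cmat.scale_sum_left)
  also have "(\<Sum>S\<in>level t. (- 1) ^ card (S \<inter> T)) = complex_of_real (krawtchouk t j)"
    using sum_sign_card_Int_subsets[OF _ T'(1), of "2*t", where 'a=complex]
    by (simp add: lev krawtchouk_def T'(2))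
  finally have "cscale (of_real (frame_const t)) (basis_twirl B A) = cscale (of_real (krawtchouk t j)) A" .
  then have "cscale (of_real (1 / frame_const t)) (cscale (of_real (frame_const t)) (basis_twirl B A)) =
      cscale (of_real (1 / frame_const t)) (cscale (of_real (krawtchouk t j)) A)" by simp
  then have "basis_twirl B A = cscale (of_real (krawtchouk t j / frame_const t)) A"
    using frame_const_pos[of t] by simp
  with step show ?case
    by (simp add: basis_twirl_add basis_twirl_cscale cmat.scale_right_distrib mult.commute)
qed

lemma W_coeff_metric:
  assumes t: "2 * t \<le> n" and j: "2 * j \<le> n"
  shows "W_coeff P metric t j = krawtchouk t j / frame_const t"
proof (rule W_coeff_eqI[where w = "\<lambda>j. krawtchouk t j / frame_const t"]; unfold metric_radius_eq)
  show "\<exists>S. finite S \<and> graded_part P metric i = cmat.span S" if "i \<le> n div 2" for i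
    using graded_part_eq[OF that] finite_level by blast
  show "\<exists>X\<in>graded_part P metric i \<inter> selfadjoint_operators P. X \<noteq> 0" if i: "i \<le> n div 2" for i
  proof -
    obtain S where S: "S \<in> level i" using level_nonempty[of i] i by fastforce
    let ?A = "semimonomial S"
    have A: "cscale c ?A \<in> graded_part P metric i" "cscale c ?A \<in> operators P" for c
      using S by (auto simp: graded_part_eq[OF i] operators_def P_semimonomial semimonomial_P
          intro: cmat.span_scale cmat.span_base)
    \<comment> \<open>The adjoint of a semimonomial is plus or minus itself; a factor
      \<open>\<i>\<close> makes the skew case self-adjoint.\<close>
    obtain c where "c \<noteq> 0" "adjoint_mat (cscale c ?A) = cscale c ?A"
    proof -
      from semimonomial_adjoint[OF S] consider "adjoint_mat ?A = ?A" | "adjoint_mat ?A = - ?A" by auto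
      then show thesis using that[of 1] that[of \<i>] by cases simp_all
    qed
    then show ?thesis
      using A[of c] semimonomial_nonzero[of S]
      by (intro bexI[of _ "cscale c ?A"]) (auto simp: selfadjoint_operators_def)
  qed
  show "hs_inner X Y = 0" if "i \<le> n div 2" "k \<le> n div 2" "i \<noteq> k"
    "X \<in> graded_part P metric i" "Y \<in> graded_part P metric k" for i k X Y
    using that(4,5) unfolding graded_part_eq[OF that(1)] graded_part_eq[OF that(2)]
    by (rule hs_inner_span_span) (use that in \<open>auto intro: level_orthogonal\<close>)
  show "operators P \<subseteq> cmat.span (\<Union>i\<le>n div 2. graded_part P metric i)"
    unfolding filtration_top[symmetric] filtration_def
    using graded_part_eq by (intro cmat.span_mono) (auto intro: cmat.span_base)
  show "basis_twirl B X = cscale (of_real (krawtchouk t i / frame_const t)) X"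
    if "hs_orthonormal_basis B (graded_part P metric t)" "i \<le> n div 2" "X \<in> graded_part P metric i"
    for B i X
    using basis_twirl_eigen[OF t, of B X i] that graded_part_eq[of t] graded_part_eq[of i] t by simp
qed (use t j in auto)

end


subsection \<open>The Jordan--Wigner operators\<close>

lemma tensor_op_nth: "tensor_op M $ x $ y = (\<Prod>i\<in>UNIV. M i $ x i $ y i)"
  by (simp add: tensor_op_def)

text \<open>Distributing the product over sites of the sums over one bit gives a sum over bit
  strings \<open>z\<close>.\<close>

lemma tensor_op_mult: "tensor_op M ** tensor_op N = tensor_op (\<lambda>i. M i ** N i)"
proof -
  have "(\<Prod>i\<in>UNIV. \<Sum>b\<in>UNIV. M i $ x i $ b * N i $ b $ y i) =
      (\<Sum>z\<in>UNIV. (\<Prod>i\<in>UNIV. M i $ x i $ z i) * (\<Prod>i\<in>UNIV. N i $ z i $ y i))" for x y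
    by (subst prod_sum_PiE) (simp_all add: PiE_UNIV_domain prod.distrib)
  then show ?thesis by (simp add: vec_eq_iff matrix_mult_nth tensor_op_nth)
qed

lemma adjoint_tensor_op: "adjoint_mat (tensor_op M) = tensor_op (\<lambda>i. adjoint_mat (M i))"
  by (simp add: vec_eq_iff tensor_op_nth cnj_prod)

lemma tensor_op_one: "tensor_op (\<lambda>_. mat 1) = mat 1"
proof -
  have "(\<Prod>i\<in>UNIV. (mat 1 :: complex^bool^bool) $ x i $ y i) = (if x = y then 1 else 0)"
    for x y :: "'a \<Rightarrow> bool"
    by (auto simp: mat_def fun_eq_iff)
  then show ?thesis by (simp add: vec_eq_iff tensor_op_nth mat_def)
qed

text \<open>Each entry is a product over sites, and exactly one site changes sign.\<close>

lemma tensor_op_anticommute: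
  assumes "M a ** N a = - (N a ** M a)" "\<And>i. i \<noteq> a \<Longrightarrow> M i ** N i = N i ** M i"
  shows "tensor_op M ** tensor_op N = cscale (- 1) (tensor_op N ** tensor_op M)"
proof -
  have "(\<Prod>i\<in>UNIV. (M i ** N i) $ x i $ y i) = - (\<Prod>i\<in>UNIV. (N i ** M i) $ x i $ y i)" for x y
    using assms by (simp add: prod.remove[of UNIV a])
  then show ?thesis by (simp add: tensor_op_mult vec_eq_iff tensor_op_nth)
qed

lemma pauli_square:
  "sigma_x ** sigma_x = mat 1" "sigma_y ** sigma_y = mat 1" "sigma_z ** sigma_z = mat 1"
  by (auto simp: vec_eq_iff matrix_mult_nth sigma_x_def sigma_y_def sigma_z_def mat_def UNIV_bool)

lemma pauli_adjoint:
  "adjoint_mat sigma_x = sigma_x" "adjoint_mat sigma_y = sigma_y" "adjoint_mat sigma_z = sigma_z"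
  by (auto simp: vec_eq_iff sigma_x_def sigma_y_def sigma_z_def)

lemma pauli_anticommute:
  "sigma_x ** sigma_y = - (sigma_y ** sigma_x)"
  "sigma_x ** sigma_z = - (sigma_z ** sigma_x)" "sigma_z ** sigma_x = - (sigma_x ** sigma_z)"
  "sigma_y ** sigma_z = - (sigma_z ** sigma_y)" "sigma_z ** sigma_y = - (sigma_y ** sigma_z)"
  by (auto simp: vec_eq_iff matrix_mult_nth sigma_x_def sigma_y_def sigma_z_def UNIV_bool)

lemma site_less_iff: "site i < site j \<longleftrightarrow> i < j"
proof -
  have "site i < site j" if "i < j" for i j :: 'a
    unfolding site_def using that by (intro psubset_card_mono) auto
  moreover have "site i \<le> site j" if "i \<le> j" for i j :: 'a
    unfolding site_def using that by (intro card_mono) auto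
  ultimately show ?thesis by (metis not_le)
qed

lemma site_eq_iff: "site i = site j \<longleftrightarrow> i = j"
  by (metis site_less_iff less_irrefl neq_iff)

lemma range_site: "range (site :: 'n::{finite,linorder} \<Rightarrow> nat) = {1..CARD('n)}"
proof (rule card_subset_eq)
  have "inj (site :: 'n \<Rightarrow> nat)" by (simp add: inj_def site_eq_iff)
  then show "card (range (site :: 'n \<Rightarrow> nat)) = card {1..CARD('n)}" by (simp add: card_image)
  show "range (site :: 'n \<Rightarrow> nat) \<subseteq> {1..CARD('n)}"
    by (auto simp: site_def card_gt_0_iff Suc_le_eq intro!: card_mono)
qed simp

lemma jordan_wigner_square:
  assumes "S ** S = mat 1"
  shows "jordan_wigner k S ** jordan_wigner k S = mat 1"
  unfolding jordan_wigner_def tensor_op_mult tensor_op_one[symmetric]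
  by (rule arg_cong[where f = tensor_op]) (auto simp: fun_eq_iff assms pauli_square)

lemma jordan_wigner_adjoint:
  assumes "adjoint_mat S = S"
  shows "adjoint_mat (jordan_wigner k S) = jordan_wigner k S"
  unfolding jordan_wigner_def adjoint_tensor_op
  by (rule arg_cong[where f = tensor_op]) (auto simp: fun_eq_iff assms pauli_adjoint)

text \<open>Only site \<open>a\<close> produces a sign, where \<open>S\<close> meets
  \<open>sigma_z\<close>: earlier sites carry \<open>sigma_z\<close> in both operators, and later
  ones the identity in the first.\<close>

lemma jordan_wigner_anticommute_less:
  fixes a :: "'n::{finite,linorder}"
  assumes "site a < l" "S ** sigma_z = - (sigma_z ** S)"
  shows "(jordan_wigner (site a) S :: 'n qubit_op) ** jordan_wigner l T =
    cscale (- 1) (jordan_wigner l T ** jordan_wigner (site a) S)"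
  unfolding jordan_wigner_def using assms
  by (intro tensor_op_anticommute[of _ a]) (auto simp: site_eq_iff)

lemma jordan_wigner_anticommute_same:
  fixes a :: "'n::{finite,linorder}"
  assumes "S ** T = - (T ** S)"
  shows "(jordan_wigner (site a) S :: 'n qubit_op) ** jordan_wigner (site a) T =
    cscale (- 1) (jordan_wigner (site a) T ** jordan_wigner (site a) S)"
  unfolding jordan_wigner_def using assms
  by (intro tensor_op_anticommute[of _ a]) (auto simp: site_eq_iff)

text \<open>Recovering \<open>k\<close> from the site and the Pauli matrix is what later shows that
  distinct generators at one site carry different Pauli matrices.\<close>

lemma clifford_gen_eq:
  assumes "k \<in> {1..2 * CARD('n::{finite,linorder})}"
  shows "\<exists>(a :: 'n) S. (clifford_gen k :: 'n qubit_op) = jordan_wigner (site a) S \<and>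
    k = (if S = sigma_x then site a else CARD('n) + site a) \<and> (S = sigma_x \<or> S = sigma_y)"
proof -
  have ne: "sigma_y \<noteq> sigma_x"
    by (auto simp: sigma_x_def sigma_y_def vec_eq_iff)
  show ?thesis
  proof (cases "k \<le> CARD('n)")
    case True
    then have "k \<in> range (site :: 'n \<Rightarrow> nat)" using assms unfolding range_site by simp
    then obtain a :: 'n where "k = site a" by blast
    with True show ?thesis
      by (intro exI[of _ a] exI[of _ sigma_x]) (simp add: clifford_gen_def)
  next
    case False
    then have "k - CARD('n) \<in> range (site :: 'n \<Rightarrow> nat)" using assms unfolding range_site by auto
    then obtain a :: 'n where a: "k - CARD('n) = site a" by blast
    with False ne show ?thesis
      by (intro exI[of _ a] exI[of _ sigma_y]) (auto simp: clifford_gen_def)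
  qed
qed

lemma clifford_gen_anticommute:
  assumes "k \<in> {1..2 * CARD('n::{finite,linorder})}" "l \<in> {1..2 * CARD('n)}" "k \<noteq> l"
  shows "(clifford_gen k :: 'n qubit_op) ** clifford_gen l = cscale (- 1) (clifford_gen l ** clifford_gen k)"
proof -
  obtain a :: 'n and S where a: "(clifford_gen k :: 'n qubit_op) = jordan_wigner (site a) S"
      "k = (if S = sigma_x then site a else CARD('n) + site a)" "S = sigma_x \<or> S = sigma_y"
    using clifford_gen_eq[OF assms(1)] by blast
  obtain b :: 'n and T where b: "(clifford_gen l :: 'n qubit_op) = jordan_wigner (site b) T"
      "l = (if T = sigma_x then site b else CARD('n) + site b)" "T = sigma_x \<or> T = sigma_y"
    using clifford_gen_eq[OF assms(2)] by blast
  have z: "S ** sigma_z = - (sigma_z ** S)" "T ** sigma_z = - (sigma_z ** T)"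
    using a(3) b(3) pauli_anticommute(2,4) by blast+
  consider "site a < site b" | "site b < site a" | "a = b" by (metis site_less_iff neq_iff)
  then show ?thesis
  proof cases
    case 1
    then show ?thesis unfolding a(1) b(1) by (rule jordan_wigner_anticommute_less[OF _ z(1)])
  next
    case 2
    then show ?thesis unfolding a(1) b(1) using jordan_wigner_anticommute_less[OF 2 z(2), of S] by simp
  next
    case 3
    \<comment> \<open>At a common site, equal Pauli matrices would give
      \<open>k = l\<close>.\<close>
    then have "S \<noteq> T" using a(2) b(2) assms(3) by auto
    then have "S = sigma_x \<and> T = sigma_y \<or> S = sigma_y \<and> T = sigma_x"
      using a(3) b(3) by blast
    then have "S ** T = - (T ** S)"
      using pauli_anticommute(1) by (elim disjE conjE) simp_all
    then show ?thesis unfolding a(1) b(1) 3 by (rule jordan_wigner_anticommute_same)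
  qed
qed

text \<open>The bit parity operator, signed so that it equals 1 exactly on basis states of chirality
  \<open>c\<close>.\<close>

definition chirality_op :: "chirality \<Rightarrow> ('n::finite) qubit_op" where
  "chirality_op c = cscale (if c = Plus then 1 else - 1) (tensor_op (\<lambda>_. sigma_z))"

lemma tensor_sigma_z_nth:
  "tensor_op (\<lambda>_. sigma_z) $ x $ y = (if x = y then (- 1) ^ card {i. x i} else 0)"
proof (cases "x = y")
  case True
  have "(\<Prod>i\<in>UNIV. sigma_z $ x i $ x i) = (\<Prod>i\<in>UNIV. if x i then - 1 else (1 :: complex))"
    by (intro prod.cong) (auto simp: sigma_z_def)
  also have "\<dots> = (- 1) ^ card {i. x i}"
    by (simp add: prod.If_cases)
  finally show ?thesis using True by (simp add: tensor_op_nth)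
next
  case False
  then show ?thesis by (auto simp: tensor_op_nth sigma_z_def fun_eq_iff)
qed

lemma semispin_proj_eq: "semispin_proj c = cscale (1 / 2) (mat 1 + chirality_op c)"
  by (cases c) (auto simp: vec_eq_iff semispin_proj_def chirality_op_def tensor_sigma_z_nth mat_def)

lemma chirality_op_anticommute:
  assumes "k \<in> {1..2 * CARD('n::{finite,linorder})}"
  shows "(chirality_op c :: 'n qubit_op) ** clifford_gen k = cscale (- 1) (clifford_gen k ** chirality_op c)"
proof -
  obtain a :: 'n and S where a: "(clifford_gen k :: 'n qubit_op) = jordan_wigner (site a) S"
      "S = sigma_x \<or> S = sigma_y"
    using clifford_gen_eq[OF assms] by blast
  then have "sigma_z ** S = - (S ** sigma_z)" using pauli_anticommute(3,5) by blast
  then have "tensor_op (\<lambda>_. sigma_z) ** (clifford_gen k :: 'n qubit_op) =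
      cscale (- 1) (clifford_gen k ** tensor_op (\<lambda>_. sigma_z))"
    unfolding a(1) jordan_wigner_def by (intro tensor_op_anticommute[of _ a]) (auto simp: site_eq_iff)
  then show ?thesis by (simp add: chirality_op_def)
qed

lemma semispinor_qubits:
  "semispinor (clifford_gen :: nat \<Rightarrow> 'n qubit_op) CARD('n::{finite,linorder}) (chirality_op c) (semispin_proj c)"
proof
  show "CARD('n \<Rightarrow> bool) = 2 ^ CARD('n)" by (simp add: card_fun)
  show "0 < CARD('n)" by simp
  show "clifford_gen k ** clifford_gen k = (mat 1 :: 'n qubit_op)" if "k \<in> {1..2 * CARD('n)}" for k
    using clifford_gen_eq[OF that] by (auto simp: jordan_wigner_square pauli_square)
  show "adjoint_mat (clifford_gen k) = (clifford_gen k :: 'n qubit_op)" if "k \<in> {1..2 * CARD('n)}" for k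
    using clifford_gen_eq[OF that] by (auto simp: jordan_wigner_adjoint pauli_adjoint)
  show "chirality_op c ** chirality_op c = (mat 1 :: 'n qubit_op)"
    by (simp add: chirality_op_def tensor_op_mult pauli_square tensor_op_one)
  show "adjoint_mat (chirality_op c) = (chirality_op c :: 'n qubit_op)"
    by (simp add: chirality_op_def adjoint_tensor_op pauli_adjoint)
qed (fact clifford_gen_anticommute chirality_op_anticommute semispin_proj_eq)+

theorem proposition3p6p5:
  fixes n :: nat and c :: chirality
  assumes "CARD('n::{finite,linorder}) = n"
  shows "(\<forall>t j. 2 * t < n \<longrightarrow> 2 * j \<le> n \<longrightarrow>
           W_coeff (semispin_proj c :: 'n qubit_op) (semispin_metric c) t j =
             1 / 2 ^ (n - 1) *
             (\<Sum>s = 0..2 * t. (-1) ^ s * real ((2 * j) choose s) * real ((2 * n - 2 * j) choose (2 * t - s)))) \<and>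
         (even n \<longrightarrow> (\<forall>j. 2 * j \<le> n \<longrightarrow>
           W_coeff (semispin_proj c :: 'n qubit_op) (semispin_metric c) (n div 2) j =
             1 / 2 ^ n *
             (\<Sum>s = 0..n. (-1) ^ s * real ((2 * j) choose s) * real ((2 * n - 2 * j) choose (n - s)))))"
proof -
  interpret semispinor "clifford_gen :: nat \<Rightarrow> 'n qubit_op" n "chirality_op c" "semispin_proj c"
    using semispinor_qubits[where 'n='n] unfolding assms .
  have metric: "semispin_metric c = metric"
    by (rule ext) (simp add: semispin_metric_def metric_def semispin_generators_def generators_def assms)
  show ?thesis
    \<comment> \<open>The two claims are the two branches of \<open>frame_const\<close>:
      \<open>2 * t < n\<close>, and \<open>t = n div 2\<close> with \<open>n\<close> even.\<close>
    using W_coeff_metric unfolding metric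
    by (auto simp: frame_const_def krawtchouk_def)
qed

end
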